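(* Let $W$ be an irreducible, non-dihedral finite Coxeter group of rank $n$ with set of reflections $T$. Suppose that for every $g \in W$ and every pair $\underline{t}, \underline{t}'$ of full reflection factorizations of $g$ in $W$ satisfying $$m_C(\underline{t}) = m_C(\underline{t}') \le b_C + n \qquad \text{for every } W\text{-conjugacy class } C \subseteq T,$$ one has $\underline{t} \sim \underline{t}'$. Then for every $g\in W$ and every pair $\underline{t}, \underline{t}'$ of full reflection factorizations of $g$ in $W$ with $m_C(\underline{t}) = m_C(\underline{t}')$ for every $W$-conjugacy class $C\subseteq T$ (with no bound), one has $\underline{t}\sim\underline{t}'$.
   Context: A Coxeter group $W$ comes with its distinguished generating set $S$ of simple reflections; its rank is $|S|$, and its set of reflections is $T=\{gsg^{-1} : g\in W,\ s\in S\}$. A reflection factorization of $g\in W$ is a tuple $(t_1,\dots,t_m)\in T^m$ with $g=t_1\cdots t_m$; it is full in $W$ if $\langle t_1,\dots,t_m\rangle=W$. For a $W$-conjugacy class $C\subseteq T$, $m_C((t_1,\dots,t_m))=|\{i : 1\le i\le m,\ t_i\in C\}|$. For a finite irreducible Coxeter group $W$ of rank $n$, a minimal reflection generating set is a subset $R\subseteq T$ with $\langle R\rangle=W$ and $|R|=n$, and $b_C:=|R\cap C|$ for each $W$-conjugacy class $C\subseteq T$; this number is known not to depend on the choice of the minimal reflection generating set $R$ (for instance, one may take $R=S$). The braid group $\mathcal{B}_m$ with standard generators $\sigma_1,\dots,\sigma_{m-1}$ acts on $T^m$ by the Hurwitz action $$\sigma_i\cdot(t_1,\dots,t_m)=(t_1,\dots,t_{i-1},\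 t_{i+1},\ t_{i+1}^{-1}t_it_{i+1},\ t_{i+2},\dots,t_m),$$ with $\sigma_i^{-1}\cdot(t_1,\dots,t_m)=(t_1,\dots,t_{i-1},\ t_it_{i+1}t_i^{-1},\ t_i,\ t_{i+2},\dots,t_m)$. One writes $\underline{t}\sim\underline{r}$ (Hurwitz equivalent) if the tuples lie in the same orbit. *)

theory Defs
  imports "HOL-Algebra.Algebra"
begin

section \<open>Group presentations\<close>

text \<open>Words in the free group on a set \<open>S\<close> are lists over \<open>S \<times> UNIV\<close>; the letter \<open>(s, True)\<close> stands
  for \<open>s\<close> and \<open>(s, False)\<close> for its formal inverse.  Two words are related by \<open>pres_equiv S Q\<close> iff
  they represent the same element of the group with generators \<open>S\<close> and relators \<open>Q\<close>.\<close>

type_synonym 'a gword = "('a \<times> bool) list"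

inductive pres_equiv :: "'a set \<Rightarrow> 'a gword set \<Rightarrow> 'a gword \<Rightarrow> 'a gword \<Rightarrow> bool"
  for S :: "'a set" and Q :: "'a gword set" where
  cancel: "\<lbrakk>u \<in> lists (S \<times> UNIV); v \<in> lists (S \<times> UNIV); s \<in> S\<rbrakk>
             \<Longrightarrow> pres_equiv S Q (u @ [(s, e), (s, \<not> e)] @ v) (u @ v)"
| relator: "\<lbrakk>u \<in> lists (S \<times> UNIV); v \<in> lists (S \<times> UNIV); q \<in> Q\<rbrakk>
             \<Longrightarrow> pres_equiv S Q (u @ q @ v) (u @ v)"
| refl: "w \<in> lists (S \<times> UNIV) \<Longrightarrow> pres_equiv S Q w w"
| sym: "pres_equiv S Q u v \<Longrightarrow> pres_equiv S Q v u"
| trans: "\<lbrakk>pres_equiv S Q u v; pres_equiv S Q v w\<rbrakk> \<Longrightarrow> pres_equiv S Q u w"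

definition eval_gword :: "('a, 'b) monoid_scheme \<Rightarrow> 'a gword \<Rightarrow> 'a" where
  "eval_gword G w = foldr (\<lambda>(s, e) x. (if e then s else inv\<^bsub>G\<^esub> s) \<otimes>\<^bsub>G\<^esub> x) w \<one>\<^bsub>G\<^esub>"

definition has_presentation :: "('a, 'b) monoid_scheme \<Rightarrow> 'a set \<Rightarrow> 'a gword set \<Rightarrow> bool" where
  "has_presentation G S Q \<longleftrightarrow>
     S \<subseteq> carrier G \<and> Q \<subseteq> lists (S \<times> UNIV) \<and> generate G S = carrier G \<and>
     (\<forall>w \<in> lists (S \<times> UNIV). eval_gword G w = \<one>\<^bsub>G\<^esub> \<longleftrightarrow> pres_equiv S Q w [])"


section \<open>Coxeter systems\<close>

text \<open>The Coxeter relators \<open>(s t)\<close> to the power \<open>m(s,t)\<close>, where \<open>m(s,t)\<close> is the order of \<open>s t\<close>.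
  As \<^const>\<open>group.ord\<close> is 0 for elements of infinite order, such pairs give the empty relator.\<close>

definition coxeter_relators :: "('a, 'b) monoid_scheme \<Rightarrow> 'a set \<Rightarrow> 'a gword set" where
  "coxeter_relators W S =
     {concat (replicate (group.ord W (s \<otimes>\<^bsub>W\<^esub> t)) [(s, True), (t, True)]) | s t. s \<in> S \<and> t \<in> S}"

definition coxeter_system :: "('a, 'b) monoid_scheme \<Rightarrow> 'a set \<Rightarrow> bool" where
  "coxeter_system W S \<longleftrightarrow>
     group W \<and> S \<subseteq> carrier W \<and> (\<forall>s\<in>S. group.ord W s = 2) \<and>
     has_presentation W S (coxeter_relators W S)"

definition coxeter_graph :: "('a, 'b) monoid_scheme \<Rightarrow> 'a set \<Rightarrow> ('a \<times> 'a) set" where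
  "coxeter_graph W S = {(s, t). s \<in> S \<and> t \<in> S \<and> s \<noteq> t \<and> group.ord W (s \<otimes>\<^bsub>W\<^esub> t) \<noteq> 2}"

text \<open>Irreducible: the Coxeter graph is nonempty and connected.\<close>

definition irreducible_coxeter_system :: "('a, 'b) monoid_scheme \<Rightarrow> 'a set \<Rightarrow> bool" where
  "irreducible_coxeter_system W S \<longleftrightarrow>
     coxeter_system W S \<and> S \<noteq> {} \<and> (\<forall>s\<in>S. \<forall>t\<in>S. (s, t) \<in> (coxeter_graph W S)\<^sup>*)"

text \<open>Dihedral is meant in the sense of Coxeter groups, i.e. type \<open>I\<^sub>2(m)\<close>: generated by exactly
  two simple reflections.  In particular the group of order 2 (rank 1) is not dihedral.\<close>

definition dihedral_coxeter_system :: "('a, 'b) monoid_scheme \<Rightarrow> 'a set \<Rightarrow> bool" where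
  "dihedral_coxeter_system W S \<longleftrightarrow>
     coxeter_system W S \<and> (\<exists>s t. s \<noteq> t \<and> S = {s, t})"

definition reflections :: "('a, 'b) monoid_scheme \<Rightarrow> 'a set \<Rightarrow> 'a set" where
  "reflections W S = {g \<otimes>\<^bsub>W\<^esub> s \<otimes>\<^bsub>W\<^esub> inv\<^bsub>W\<^esub> g | g s. g \<in> carrier W \<and> s \<in> S}"

definition conjugacy_class :: "('a, 'b) monoid_scheme \<Rightarrow> 'a \<Rightarrow> 'a set" where
  "conjugacy_class W x = {g \<otimes>\<^bsub>W\<^esub> x \<otimes>\<^bsub>W\<^esub> inv\<^bsub>W\<^esub> g | g. g \<in> carrier W}"

definition reflection_classes :: "('a, 'b) monoid_scheme \<Rightarrow> 'a set \<Rightarrow> 'a set set" where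
  "reflection_classes W S =
     {C. (\<exists>x \<in> carrier W. C = conjugacy_class W x) \<and> C \<subseteq> reflections W S}"

definition minimal_reflection_generating_set ::
    "('a, 'b) monoid_scheme \<Rightarrow> 'a set \<Rightarrow> 'a set \<Rightarrow> bool" where
  "minimal_reflection_generating_set W S R \<longleftrightarrow>
     R \<subseteq> reflections W S \<and> generate W R = carrier W \<and> card R = card S"


section \<open>Reflection factorizations and the Hurwitz action\<close>

definition reflection_factorization ::
    "('a, 'b) monoid_scheme \<Rightarrow> 'a set \<Rightarrow> 'a \<Rightarrow> 'a list \<Rightarrow> bool" where
  "reflection_factorization W S g ts \<longleftrightarrow>
     set ts \<subseteq> reflections W S \<and> foldr (\<otimes>\<^bsub>W\<^esub>) ts \<one>\<^bsub>W\<^esub> = g"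

definition full_reflection_factorization ::
    "('a, 'b) monoid_scheme \<Rightarrow> 'a set \<Rightarrow> 'a \<Rightarrow> 'a list \<Rightarrow> bool" where
  "full_reflection_factorization W S g ts \<longleftrightarrow>
     reflection_factorization W S g ts \<and> generate W (set ts) = carrier W"

definition class_multiplicity :: "'a set \<Rightarrow> 'a list \<Rightarrow> nat" where
  "class_multiplicity C ts = card {i. i < length ts \<and> ts ! i \<in> C}"

text \<open>The orbits of the braid group, which is generated by the \<open>\<sigma>\<^sub>i\<close>, are the classes of the
  reflexive transitive closure of the moves \<open>\<sigma>\<^sub>i\<close> and their inverses (here \<open>i = length us + 1\<close>).\<close>

inductive hurwitz_move :: "('a, 'b) monoid_scheme \<Rightarrow> 'a list \<Rightarrow> 'a list \<Rightarrow> bool"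
  for W :: "('a, 'b) monoid_scheme" where
  sigma: "hurwitz_move W (us @ [a, b] @ vs) (us @ [b, inv\<^bsub>W\<^esub> b \<otimes>\<^bsub>W\<^esub> a \<otimes>\<^bsub>W\<^esub> b] @ vs)"
| sigma_inv: "hurwitz_move W (us @ [a, b] @ vs) (us @ [a \<otimes>\<^bsub>W\<^esub> b \<otimes>\<^bsub>W\<^esub> inv\<^bsub>W\<^esub> a, a] @ vs)"

definition hurwitz_equiv :: "('a, 'b) monoid_scheme \<Rightarrow> 'a list \<Rightarrow> 'a list \<Rightarrow> bool" where
  "hurwitz_equiv W = (hurwitz_move W)\<^sup>*\<^sup>*"

end

theory Submission
  imports Defs "HOL-Library.Function_Algebras"
begin

text \<open>
  Suppose that a class \<open>C\<close> has more than \<open>b\<^sub>C + n\<close> entries in a full factorization \<open>t\<close> of \<open>g\<close>.  The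
  heart of the proof is that \<open>t\<close> is then Hurwitz equivalent to \<open>u @ [r, r]\<close> with \<open>r \<in> C\<close> and \<open>u\<close>
  still full (\<open>full_factorization_split\<close>); as \<open>r\<close> is an involution, \<open>u\<close> is a shorter full
  factorization of \<open>g\<close>.  If \<open>t'\<close> has the same multiplicities, it is equivalent to
  \<open>u' @ [r', r']\<close> in the same way.  A pair \<open>r, r\<close> can be conjugated by every element of the group
  generated by the other entries (\<open>hurwitz_pair_conj\<close>), which is all of \<open>W\<close>, so \<open>r = r'\<close> may be
  assumed, and induction on the length gives \<open>u \<sim> u'\<close> and hence \<open>t \<sim> t'\<close>.

  The pair is found by linear algebra.  In the geometric representation each reflection has a root,
  and the key fact \<open>dependent_square\<close> says that a tuple of reflections with linearly dependent roots
  is Hurwitz equivalent to one with two equal neighbours.  Moving such a duplicate to the end again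
  and again produces a prefix with independent roots that generates the same group
  (\<open>independent_prefix\<close>).  For full \<open>t\<close> this prefix has at most \<open>n\<close> entries, and at most
  \<open>|S \<inter> C| \<le> b\<^sub>C\<close> of them lie in \<open>C\<close>: the count of entries of a generating set inside or outside \<open>C\<close> is
  bounded below by the count for \<open>S\<close> (\<open>class_generators_ge\<close>), because \<open>W\<close> acts on the space
  spanned by the simple roots of \<open>S \<inter> C\<close> (or of \<open>S - C\<close>) with the other simple reflections acting
  trivially, and it fixes no nonzero vector there.  So more than \<open>n\<close> entries from \<open>C\<close> remain behind the prefix.
  Collected side by side they have dependent roots, hence produce the pair, and the prefix keeps the
  rest full.

  The proof of \<open>dependent_square\<close> needs no classification.  If \<open>t\<^sub>2, \<dots>, t\<^sub>m\<close> have independent roots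
  and the root of \<open>t\<^sub>1\<close> lies in their span, then \<open>t\<^sub>1 \<dots> t\<^sub>m\<close> fixes a vector \<open>v\<close> that \<open>t\<^sub>1\<close> moves.
  Follow \<open>v\<close> along the closed path of the vectors \<open>t\<^sub>k \<dots> t\<^sub>m v\<close>, and among all tuples in the
  (finite) Hurwitz orbit choose one for which the sum of the heights \<open>\<langle>v, t\<^sub>k \<dots> t\<^sub>m v\<rangle>\<close> is
  maximal.  By Cauchy--Schwarz \<open>v\<close> is the unique highest point.  A computation in the plane of two
  neighbouring roots shows that after a descending step every further step descends, unless two
  neighbouring reflections are equal: otherwise one of the two possible Hurwitz moves would
  raise the path.  So the path could never return to \<open>v\<close>.

  The geometric representation is built from the presentation: the simple reflections
  act by reflections for the form with entries \<open>- cos (\<pi> / m(s, t))\<close>, averaging over the finite group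
  gives an invariant inner product, and faithfulness is Tits' argument on word lengths
  (\<open>length_increase_positive\<close>).
\<close>

section \<open>Hurwitz moves\<close>

lemma hurwitz_equiv_refl [simp]: "hurwitz_equiv G xs xs"
  by (simp add: hurwitz_equiv_def)

lemma hurwitz_equiv_trans [trans]:
  "hurwitz_equiv G xs ys \<Longrightarrow> hurwitz_equiv G ys zs \<Longrightarrow> hurwitz_equiv G xs zs"
  by (simp add: hurwitz_equiv_def)

lemma hurwitz_move_imp_equiv: "hurwitz_move G xs ys \<Longrightarrow> hurwitz_equiv G xs ys"
  by (simp add: hurwitz_equiv_def)

lemma hurwitz_move_append:
  assumes "hurwitz_move G xs ys"
  shows "hurwitz_move G (us @ xs @ vs) (us @ ys @ vs)"
  using assms
proof cases
  case (sigma us' a b vs')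
  then show ?thesis
    using hurwitz_move.sigma[of G "us @ us'" a b "vs' @ vs"] by simp
next
  case (sigma_inv us' a b vs')
  then show ?thesis
    using hurwitz_move.sigma_inv[of G "us @ us'" a b "vs' @ vs"] by simp
qed

lemma hurwitz_equiv_append:
  assumes "hurwitz_equiv G xs ys"
  shows "hurwitz_equiv G (us @ xs @ vs) (us @ ys @ vs)"
  using assms unfolding hurwitz_equiv_def
  by (induction rule: rtranclp_induct) (auto intro: rtranclp.rtrancl_into_rtrancl hurwitz_move_append)

lemma hurwitz_equiv_length: "hurwitz_equiv G xs ys \<Longrightarrow> length ys = length xs"
  unfolding hurwitz_equiv_def
  by (induction rule: rtranclp_induct) (auto elim: hurwitz_move.cases)

context group
begin

lemma inv_cancel_left:
  assumes "g \<in> carrier G" "x \<in> carrier G"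
  shows "inv g \<otimes> (g \<otimes> x) = x" "g \<otimes> (inv g \<otimes> x) = x"
  using assms by (simp_all flip: m_assoc)

lemma involution_cancel_left:
  assumes "r \<in> carrier G" "r \<otimes> r = \<one>" "x \<in> carrier G"
  shows "r \<otimes> (r \<otimes> x) = x"
  using assms by (simp flip: m_assoc)

lemma conj_involution:
  assumes "g \<in> carrier G" "r \<in> carrier G" "r \<otimes> r = \<one>"
  shows "(g \<otimes> r \<otimes> inv g) \<otimes> (g \<otimes> r \<otimes> inv g) = \<one>"
  using assms by (simp add: m_assoc inv_cancel_left involution_cancel_left)


lemma hurwitz_move_subgroup:
  assumes "hurwitz_move G xs ys" "subgroup H G" "set xs \<subseteq> H"
  shows "set ys \<subseteq> H"
  using assms(1)
proof cases
  case (sigma us a b vs)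
  with assms show ?thesis
    by (auto intro!: subgroup.m_closed subgroup.m_inv_closed)
next
  case (sigma_inv us a b vs)
  with assms show ?thesis
    by (auto intro!: subgroup.m_closed subgroup.m_inv_closed)
qed

lemma hurwitz_equiv_subgroup:
  assumes "hurwitz_equiv G xs ys" "subgroup H G" "set xs \<subseteq> H"
  shows "set ys \<subseteq> H"
  using assms unfolding hurwitz_equiv_def
  by (induction rule: rtranclp_induct) (auto dest: hurwitz_move_subgroup)

lemmas hurwitz_equiv_carrier = hurwitz_equiv_subgroup[OF _ subgroup_self]

lemma hurwitz_move_sym:
  assumes "hurwitz_move G xs ys" "set xs \<subseteq> carrier G"
  shows "hurwitz_move G ys xs"
  using assms(1)
proof cases
  case (sigma us a b vs)
  with assms(2) have *: "a \<in> carrier G" "b \<in> carrier G" by auto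
  have "b \<otimes> (inv b \<otimes> a \<otimes> b) \<otimes> inv b = a"
    using * by (simp add: m_assoc inv_cancel_left)
  then show ?thesis
    using hurwitz_move.sigma_inv[of G us b "inv b \<otimes> a \<otimes> b" vs] by (simp add: sigma)
next
  case (sigma_inv us a b vs)
  with assms(2) have *: "a \<in> carrier G" "b \<in> carrier G" by auto
  have "inv a \<otimes> (a \<otimes> b \<otimes> inv a) \<otimes> a = b"
    using * by (simp add: m_assoc inv_cancel_left)
  then show ?thesis
    using hurwitz_move.sigma[of G us "a \<otimes> b \<otimes> inv a" a vs] by (simp add: sigma_inv)
qed

lemma hurwitz_equiv_sym:
  assumes "hurwitz_equiv G xs ys" "set xs \<subseteq> carrier G"
  shows "hurwitz_equiv G ys xs"
  using assms(1) unfolding hurwitz_equiv_def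
proof (induction rule: rtranclp_induct)
  case (step ys zs)
  have "set ys \<subseteq> carrier G"
    using hurwitz_equiv_carrier[of xs ys] step(1) assms(2) by (simp add: hurwitz_equiv_def)
  with step show ?case
    by (meson converse_rtranclp_into_rtranclp hurwitz_move_sym)
qed simp

lemma hurwitz_equiv_generate:
  assumes "hurwitz_equiv G xs ys" "set xs \<subseteq> carrier G"
  shows "generate G (set ys) = generate G (set xs)"
proof -
  have *: "generate G (set vs) \<subseteq> generate G (set us)"
    if "hurwitz_equiv G us vs" "set us \<subseteq> carrier G" for us vs
    using hurwitz_equiv_subgroup[OF that(1) generate_is_subgroup[OF that(2)]]
      generate_subgroup_incl[OF _ generate_is_subgroup[OF that(2)]] 
    by (meson generate.incl subsetI)
  show ?thesis
    using *[OF assms] *[OF hurwitz_equiv_sym[OF assms] hurwitz_equiv_carrier[OF assms]] by blast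
qed

lemma foldr_mult_carrier [simp, intro]:
  "set xs \<subseteq> carrier G \<Longrightarrow> foldr (\<otimes>) xs \<one> \<in> carrier G"
  by (induction xs) auto

lemma foldr_mult_append:
  "set xs \<subseteq> carrier G \<Longrightarrow> set ys \<subseteq> carrier G \<Longrightarrow>
     foldr (\<otimes>) (xs @ ys) \<one> = foldr (\<otimes>) xs \<one> \<otimes> foldr (\<otimes>) ys \<one>"
  by (induction xs) (auto simp: m_assoc)

lemma hurwitz_move_prod:
  assumes "hurwitz_move G xs ys" "set xs \<subseteq> carrier G"
  shows "foldr (\<otimes>) ys \<one> = foldr (\<otimes>) xs \<one>"
  using assms(1)
proof cases
  case (sigma us a b vs)
  with assms(2) have *: "a \<in> carrier G" "b \<in> carrier G" "set vs \<subseteq> carrier G"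
    by auto
  have "b \<otimes> (inv b \<otimes> a \<otimes> b \<otimes> foldr (\<otimes>) vs \<one>) = a \<otimes> (b \<otimes> foldr (\<otimes>) vs \<one>)"
    using * by (simp add: m_assoc inv_cancel_left)
  then show ?thesis unfolding sigma by simp
next
  case (sigma_inv us a b vs)
  with assms(2) have *: "a \<in> carrier G" "b \<in> carrier G" "set vs \<subseteq> carrier G"
    by auto
  have "a \<otimes> b \<otimes> inv a \<otimes> (a \<otimes> foldr (\<otimes>) vs \<one>) = a \<otimes> (b \<otimes> foldr (\<otimes>) vs \<one>)"
    using * by (simp add: m_assoc inv_cancel_left)
  then show ?thesis unfolding sigma_inv by simp
qed

lemma hurwitz_equiv_prod:
  assumes "hurwitz_equiv G xs ys" "set xs \<subseteq> carrier G"
  shows "foldr (\<otimes>) ys \<one> = foldr (\<otimes>) xs \<one>"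
  using assms(1) unfolding hurwitz_equiv_def
proof (induction rule: rtranclp_induct)
  case (step ys zs)
  then show ?case
    using hurwitz_equiv_carrier[of xs ys] assms(2) hurwitz_move_prod[of ys zs]
    by (simp add: hurwitz_equiv_def)
qed simp

definition conj_closed :: "'a set \<Rightarrow> bool" where
  "conj_closed C \<longleftrightarrow> C \<subseteq> carrier G \<and> (\<forall>x\<in>C. \<forall>g\<in>carrier G. g \<otimes> x \<otimes> inv g \<in> C)"

lemma conj_closedD:
  assumes "conj_closed C" "x \<in> C" "g \<in> carrier G"
  shows "g \<otimes> x \<otimes> inv g \<in> C" "inv g \<otimes> x \<otimes> g \<in> C"
  using assms inv_closed[of g] inv_inv[of g] unfolding conj_closed_def by metis+

lemma conj_closed_iff:
  assumes "conj_closed C" "x \<in> carrier G" "g \<in> carrier G"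
  shows "g \<otimes> x \<otimes> inv g \<in> C \<longleftrightarrow> x \<in> C" "inv g \<otimes> x \<otimes> g \<in> C \<longleftrightarrow> x \<in> C"
proof -
  have eq: "inv g \<otimes> (g \<otimes> x \<otimes> inv g) \<otimes> g = x" "g \<otimes> (inv g \<otimes> x \<otimes> g) \<otimes> inv g = x"
    using assms(2,3) by (simp_all add: m_assoc inv_cancel_left)
  show "g \<otimes> x \<otimes> inv g \<in> C \<longleftrightarrow> x \<in> C" "inv g \<otimes> x \<otimes> g \<in> C \<longleftrightarrow> x \<in> C"
    using conj_closedD[OF assms(1) _ assms(3)] eq by metis+
qed

lemma hurwitz_equiv_conj_closed:
  assumes "hurwitz_equiv G xs ys" "conj_closed C" "set xs \<subseteq> C"
  shows "set ys \<subseteq> C"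
  using assms(1) unfolding hurwitz_equiv_def
proof (induction rule: rtranclp_induct)
  case (step ys zs)
  have sub: "C \<subseteq> carrier G" using assms(2) by (auto simp: conj_closed_def)
  from step(2) show ?case
  proof cases
    case (sigma us a b vs)
    with step.IH sub conj_closedD[OF assms(2)] show ?thesis by auto
  next
    case (sigma_inv us a b vs)
    with step.IH sub conj_closedD[OF assms(2)] show ?thesis by auto
  qed
qed (use assms in simp)

lemma hurwitz_equiv_count:
  assumes "hurwitz_equiv G xs ys" "conj_closed C" "set xs \<subseteq> carrier G"
  shows "length (filter (\<lambda>x. x \<in> C) ys) = length (filter (\<lambda>x. x \<in> C) xs)"
  using assms(1) unfolding hurwitz_equiv_def
proof (induction rule: rtranclp_induct)
  case (step ys zs)
  have c: "set ys \<subseteq> carrier G"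
    using hurwitz_equiv_carrier[of xs ys] step(1) assms(3) by (simp add: hurwitz_equiv_def)
  from step(2) have "length (filter (\<lambda>x. x \<in> C) zs) = length (filter (\<lambda>x. x \<in> C) ys)"
  proof cases
    case (sigma us a b vs)
    with c conj_closed_iff[OF assms(2)] show ?thesis by auto
  next
    case (sigma_inv us a b vs)
    with c conj_closed_iff[OF assms(2)] show ?thesis by auto
  qed
  with step.IH show ?case by simp
qed simp

text \<open>Repeated \<open>\<sigma>\<close> moves carry the first entry to the end; the entries that it passes stay as they are,
  and only the travelling entry gets conjugated.\<close>
lemma hurwitz_move_right:
  assumes "set ys \<subseteq> carrier G" "a \<in> carrier G"
  shows "\<exists>a'\<in>carrier G. hurwitz_equiv G (a # ys) (ys @ [a'])"
  using assms
proof (induction ys arbitrary: a)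
  case (Cons y ys)
  have "hurwitz_equiv G (a # y # ys) (y # (inv y \<otimes> a \<otimes> y) # ys)"
    using hurwitz_move_imp_equiv[OF hurwitz_move.sigma[of G "[]" a y ys]] by simp
  moreover obtain a' where a': "a' \<in> carrier G"
      "hurwitz_equiv G ((inv y \<otimes> a \<otimes> y) # ys) (ys @ [a'])"
    using Cons.IH[of "inv y \<otimes> a \<otimes> y"] Cons.prems by auto
  moreover have "hurwitz_equiv G (y # (inv y \<otimes> a \<otimes> y) # ys) (y # ys @ [a'])"
    using hurwitz_equiv_append[OF a'(2), of "[y]" "[]"] by simp
  ultimately have "hurwitz_equiv G (a # y # ys) ((y # ys) @ [a'])"
    by (metis append_Cons hurwitz_equiv_trans)
  with a'(1) show ?case by blast
qed (simp, use hurwitz_equiv_refl in blast)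

text \<open>An entry outside \<open>C\<close> that stands before the entries already collected is carried past them, which
  leaves them unchanged.\<close>
lemma hurwitz_collect_class:
  assumes "set xs \<subseteq> carrier G"
  shows "\<exists>ys zs. hurwitz_equiv G xs (ys @ zs) \<and> set ys \<subseteq> C \<and>
     length ys = length (filter (\<lambda>x. x \<in> C) xs)"
  using assms
proof (induction xs)
  case (Cons x xs)
  then obtain ys zs where yz: "hurwitz_equiv G xs (ys @ zs)" "set ys \<subseteq> C"
     "length ys = length (filter (\<lambda>x. x \<in> C) xs)" by auto
  have e: "hurwitz_equiv G (x # xs) (x # ys @ zs)"
    using hurwitz_equiv_append[OF yz(1), of "[x]" "[]"] by simp
  show ?case
  proof (cases "x \<in> C")
    case True
    show ?thesis using yz e True by - (rule exI[of _ "x # ys"], rule exI[of _ zs], simp)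
  next
    case False
    have "set ys \<subseteq> carrier G" "x \<in> carrier G"
      using hurwitz_equiv_carrier[OF yz(1)] Cons.prems by auto
    then obtain x' where "hurwitz_equiv G (x # ys) (ys @ [x'])"
      using hurwitz_move_right by blast
    from hurwitz_equiv_append[OF this, of "[]" zs] e
    have "hurwitz_equiv G (x # xs) (ys @ x' # zs)" by (simp add: hurwitz_equiv_trans)
    then show ?thesis using yz False by - (rule exI[of _ ys], rule exI[of _ "x' # zs"], simp)
  qed
qed (rule exI[of _ "[]"], rule exI[of _ "[]"], simp)

text \<open>Passing both copies of \<open>r\<close> conjugates an entry by \<open>r\<close> twice, that is, by \<open>r \<otimes> r = \<one>\<close>; so a pair
  \<open>r, r\<close> commutes with everything.\<close>
lemma hurwitz_pair_right:
  assumes "set ys \<subseteq> carrier G" "r \<in> carrier G" "r \<otimes> r = \<one>"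
  shows "hurwitz_equiv G ([r, r] @ ys) (ys @ [r, r])"
  using assms(1)
proof (induction ys)
  case (Cons y ys)
  have "inv r = r" using assms by (simp add: inv_equality)
  then have "r \<otimes> (r \<otimes> y \<otimes> inv r) \<otimes> inv r = y"
    using assms Cons.prems by (simp add: m_assoc involution_cancel_left)
  then have "hurwitz_equiv G [r, r, y] [y, r, r]"
    using hurwitz_equiv_trans[OF
      hurwitz_move_imp_equiv[OF hurwitz_move.sigma_inv[of G "[r]" r y "[]", simplified append.simps]]
      hurwitz_move_imp_equiv[OF hurwitz_move.sigma_inv[of G "[]" r "r \<otimes> y \<otimes> inv r" "[r]", simplified append.simps]]]
    by simp
  from hurwitz_equiv_append[OF this, of "[]" ys]
  have "hurwitz_equiv G ([r, r] @ y # ys) ([y] @ [r, r] @ ys)" by simp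
  also have "hurwitz_equiv G \<dots> ([y] @ ys @ [r, r])"
    using hurwitz_equiv_append[of G "[r, r] @ ys" "ys @ [r, r]" "[y]" "[]"] Cons by simp
  finally show ?case by simp
qed auto

text \<open>Carry the pair next to the entry \<open>a\<close>, let \<open>a\<close> pass it with inverse moves (which conjugates the pair
  by \<open>a\<close>), and carry the new pair back across \<open>a\<close> without changing anything else.\<close>
lemma hurwitz_pair_conj_letter:
  assumes "set u \<subseteq> carrier G" "a \<in> set u" "r \<in> carrier G" "r \<otimes> r = \<one>"
  shows "hurwitz_equiv G (u @ [r, r]) (u @ [a \<otimes> r \<otimes> inv a, a \<otimes> r \<otimes> inv a])"
proof -
  define r' where "r' = a \<otimes> r \<otimes> inv a"
  have a: "a \<in> carrier G" using assms by auto
  have r': "r' \<in> carrier G" "r' \<otimes> r' = \<one>"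
    using assms a conj_involution[of a r] unfolding r'_def by simp_all
  obtain u1 u2 where u: "u = u1 @ [a] @ u2" using assms(2) by (auto dest: split_list)
  have u2: "set u2 \<subseteq> carrier G" using assms(1) u by auto
  have "hurwitz_equiv G (u @ [r, r]) (u1 @ [a] @ [r, r] @ u2)"
    using hurwitz_equiv_append[OF hurwitz_equiv_sym[OF hurwitz_pair_right[OF u2 assms(3,4)]],
        of "u1 @ [a]" "[]"] u2 assms(3) u by simp
  also have "hurwitz_equiv G (u1 @ [a] @ [r, r] @ u2) (u1 @ [r', a] @ [r] @ u2)"
    using hurwitz_move.sigma_inv[of G u1 a r "r # u2"]
    by (auto simp: r'_def intro: hurwitz_move_imp_equiv)
  also have "hurwitz_equiv G \<dots> (u1 @ [r', r'] @ ([a] @ u2))"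
    using hurwitz_move.sigma_inv[of G "u1 @ [r']" a r "u2"]
    by (auto simp: r'_def intro: hurwitz_move_imp_equiv)
  also have "hurwitz_equiv G \<dots> (u @ [r', r'])"
    using hurwitz_equiv_append[OF hurwitz_pair_right[OF _ r', of "[a] @ u2"], of u1 "[]"] a u2 u
    by simp
  finally show ?thesis by (simp add: r'_def)
qed

lemma hurwitz_pair_conj:
  assumes "set u \<subseteq> carrier G" "r \<in> carrier G" "r \<otimes> r = \<one>" "x \<in> generate G (set u)"
  shows "hurwitz_equiv G (u @ [r, r]) (u @ [x \<otimes> r \<otimes> inv x, x \<otimes> r \<otimes> inv x])"
  using assms(4,2,3)
proof (induction arbitrary: r rule: generate.induct)
  case one
  then show ?case by simp
next
  case (incl h)
  then show ?case using hurwitz_pair_conj_letter[OF assms(1)] by blast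
next
  case (inv h)
  have h: "h \<in> carrier G" using inv assms by auto
  let ?q = "inv h \<otimes> r \<otimes> inv (inv h)"
  have q: "?q \<in> carrier G" "?q \<otimes> ?q = \<one>"
    using h inv.prems conj_involution[of "inv h" r] by simp_all
  have "h \<otimes> ?q \<otimes> inv h = r"
    using h inv.prems by (simp add: m_assoc inv_cancel_left)
  with hurwitz_pair_conj_letter[OF assms(1) inv(1) q]
  have "hurwitz_equiv G (u @ [?q, ?q]) (u @ [r, r])" by simp
  then show ?case using q assms(1) by (simp add: hurwitz_equiv_sym)
next
  case (eng h1 h2)
  have h: "h1 \<in> carrier G" "h2 \<in> carrier G" using eng assms generate_in_carrier by blast+
  let ?q = "h2 \<otimes> r \<otimes> inv h2"
  have q: "?q \<in> carrier G" "?q \<otimes> ?q = \<one>"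
    using h eng.prems conj_involution[of h2 r] by simp_all
  have "h1 \<otimes> ?q \<otimes> inv h1 = h1 \<otimes> h2 \<otimes> r \<otimes> inv (h1 \<otimes> h2)"
    using h eng.prems by (simp add: inv_mult_group m_assoc)
  with hurwitz_equiv_trans[OF eng.IH(2)[OF eng.prems] eng.IH(1)[OF q]] show ?case
    by simp
qed

end

section \<open>Symmetric bilinear forms and reflections\<close>

locale symmetric_form =
  fixes V :: "'v::real_vector set" and ip :: "'v \<Rightarrow> 'v \<Rightarrow> real"
  assumes subspace_V: "subspace V"
    and ip_sym: "x \<in> V \<Longrightarrow> y \<in> V \<Longrightarrow> ip x y = ip y x"
    and ip_add_left: "x \<in> V \<Longrightarrow> y \<in> V \<Longrightarrow> z \<in> V \<Longrightarrow> ip (x + y) z = ip x z + ip y z"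
    and ip_scale_left: "x \<in> V \<Longrightarrow> z \<in> V \<Longrightarrow> ip (c *\<^sub>R x) z = c * ip x z"
begin

lemma V_closed [simp, intro]:
  "0 \<in> V" "x \<in> V \<Longrightarrow> y \<in> V \<Longrightarrow> x + y \<in> V" "x \<in> V \<Longrightarrow> y \<in> V \<Longrightarrow> x - y \<in> V"
  "x \<in> V \<Longrightarrow> c *\<^sub>R x \<in> V"
  using subspace_V by (auto simp: subspace_def intro: subspace_diff[OF subspace_V])

lemma ip_diff_left: "x \<in> V \<Longrightarrow> y \<in> V \<Longrightarrow> z \<in> V \<Longrightarrow> ip (x - y) z = ip x z - ip y z"
  using ip_add_left[of x "(-1) *\<^sub>R y" z] ip_scale_left[of y z "-1"] V_closed(4)[of y "-1"] by simp

lemma ip_add_right: "x \<in> V \<Longrightarrow> y \<in> V \<Longrightarrow> z \<in> V \<Longrightarrow> ip z (x + y) = ip z x + ip z y"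
  by (simp add: ip_sym[of z] ip_add_left)

lemma ip_diff_right: "x \<in> V \<Longrightarrow> y \<in> V \<Longrightarrow> z \<in> V \<Longrightarrow> ip z (x - y) = ip z x - ip z y"
  by (simp add: ip_sym[of z] ip_diff_left)

lemma ip_scale_right: "x \<in> V \<Longrightarrow> z \<in> V \<Longrightarrow> ip z (c *\<^sub>R x) = c * ip z x"
  by (simp add: ip_sym[of z] ip_scale_left)

lemmas ip_linear = ip_add_left ip_diff_left ip_scale_left ip_add_right ip_diff_right ip_scale_right

lemma ip_zero_left [simp]: "z \<in> V \<Longrightarrow> ip 0 z = 0"
  using ip_scale_left[of 0 z 0] by simp

lemma span_subset_V: "A \<subseteq> V \<Longrightarrow> span A \<subseteq> V"
  by (simp add: span_minimal subspace_V)

lemma orthogonal_span: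
  assumes "A \<subseteq> V" "z \<in> V" "\<And>x. x \<in> A \<Longrightarrow> ip z x = 0" "y \<in> span A"
  shows "ip z y = 0"
proof -
  have "span A \<subseteq> {y \<in> V. ip z y = 0}"
    using assms(1-3) ip_scale_right[of 0 z 0]
    by (intro span_minimal) (auto simp: subspace_def ip_linear)
  with assms(4) show ?thesis by blast
qed

definition reflect :: "'v \<Rightarrow> 'v \<Rightarrow> 'v" where
  "reflect a v = v - (2 * ip v a) *\<^sub>R a"

lemma reflect_closed [simp]: "a \<in> V \<Longrightarrow> v \<in> V \<Longrightarrow> reflect a v \<in> V"
  by (simp add: reflect_def)

lemma reflect_isometry:
  assumes "a \<in> V" "ip a a = 1" "v \<in> V" "w \<in> V"
  shows "ip (reflect a v) (reflect a w) = ip v w"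
  using assms by (simp add: reflect_def ip_linear ip_sym[of a w] algebra_simps)

lemma reflect_add: "a \<in> V \<Longrightarrow> v \<in> V \<Longrightarrow> w \<in> V \<Longrightarrow> reflect a (v + w) = reflect a v + reflect a w"
  by (simp add: reflect_def ip_linear algebra_simps)

lemma reflect_eq_self_iff:
  assumes "a \<in> V" "ip a a = 1"
  shows "reflect a v = v \<longleftrightarrow> ip v a = 0"
  using assms by (auto simp: reflect_def)

lemma reflect_invol: "a \<in> V \<Longrightarrow> ip a a = 1 \<Longrightarrow> v \<in> V \<Longrightarrow> reflect a (reflect a v) = v"
  by (simp add: reflect_def ip_linear algebra_simps)

end

locale euclidean_form = symmetric_form +
  assumes ip_pos: "x \<in> V \<Longrightarrow> x \<noteq> 0 \<Longrightarrow> ip x x > 0"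
begin

lemma ip_eq_zero: "x \<in> V \<Longrightarrow> ip x x \<le> 0 \<Longrightarrow> x = 0"
  using ip_pos by fastforce

text \<open>Gram--Schmidt: the part \<open>e\<close> of the new vector that is orthogonal to \<open>span A\<close> corrects the projection
  onto \<open>span A\<close>; if \<open>e = 0\<close>, there is nothing to correct.\<close>
lemma orthogonal_projection:
  assumes "finite A" "A \<subseteq> V" "w \<in> V"
  shows "\<exists>u\<in>span A. \<forall>x\<in>A. ip (w - u) x = 0"
  using assms
proof (induction A arbitrary: w rule: finite_induct)
  case (insert a A)
  obtain u where u: "u \<in> span A" "\<forall>x\<in>A. ip (w - u) x = 0" using insert.IH[of w] insert.prems by auto
  obtain p where p: "p \<in> span A" "\<forall>x\<in>A. ip (a - p) x = 0" using insert.IH[of a] insert.prems by auto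
  define e where "e = a - p"
  have V: "u \<in> V" "p \<in> V" "e \<in> V" "a \<in> V" "w \<in> V"
    using u(1) p(1) span_subset_V[of A] insert.prems by (auto simp: e_def)
  have ea: "ip e a = ip e e"
    using orthogonal_span[OF _ V(3) _ p(1)] p(2) V insert.prems
    by (simp add: e_def ip_linear)
  define c where "c = (if e = 0 then 0 else ip (w - u) a / ip e e)"
  have "u + c *\<^sub>R e \<in> span (insert a A)"
    using span_mono[of A "insert a A"] u(1) p(1) unfolding e_def
    by (intro span_add span_scale span_diff) (auto intro: span_base)
  moreover have "ip (w - (u + c *\<^sub>R e)) x = 0" if "x \<in> insert a A" for x
  proof -
    have xV: "x \<in> V" using that insert.prems by auto
    have eq: "ip (w - (u + c *\<^sub>R e)) x = ip (w - u) x - c * ip e x"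
      using V xV by (simp add: ip_linear algebra_simps)
    show ?thesis
    proof (cases "x = a")
      case True
      show ?thesis
      proof (cases "e = 0")
        case True
        then have "a \<in> span A" using p(1) by (simp add: e_def)
        then have "ip (w - u) a = 0"
          using orthogonal_span[of A "w - u" a] u(2) V insert.prems by auto
        with eq \<open>x = a\<close> True show ?thesis by (simp add: c_def)
      next
        case False
        then have "ip e e \<noteq> 0" using ip_pos[OF V(3)] by fastforce
        with eq \<open>x = a\<close> False show ?thesis by (simp add: c_def ea)
      qed
    next
      case False
      with that eq u(2) p(2) show ?thesis by (simp add: e_def)
    qed
  qed
  ultimately show ?case by blast
qed auto

lemma separating_vector:
  assumes "finite A" "A \<subseteq> V" "a \<in> V" "a \<notin> span A"
  shows "\<exists>z\<in>V. (\<forall>x\<in>A. ip z x = 0) \<and> ip z a \<noteq> 0"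
proof -
  obtain p where p: "p \<in> span A" "\<forall>x\<in>A. ip (a - p) x = 0"
    using orthogonal_projection assms by blast
  have V: "p \<in> V" using p(1) span_subset_V assms by blast
  have "ip (a - p) a = ip (a - p) (a - p)"
    using orthogonal_span[OF assms(2) _ _ p(1), of "a - p"] p(2) V assms(3)
    by (simp add: ip_linear)
  moreover have "a - p \<noteq> 0" using p(1) assms(4) by auto
  ultimately show ?thesis using p(2) V assms(3) ip_pos[of "a - p"]
    by (intro bexI[of _ "a - p"]) auto
qed

lemma unit_parallel:
  assumes "a \<in> V" "b \<in> V" "ip a a = 1" "ip b b = 1" "1 \<le> (ip a b)\<^sup>2" "v \<in> V"
  shows "reflect a v = reflect b v"
proof -
  define c where "c = ip a b"
  have "ip (a - c *\<^sub>R b) (a - c *\<^sub>R b) = 1 - c\<^sup>2"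
    using assms by (simp add: ip_linear c_def ip_sym[of b a] algebra_simps power2_eq_square)
  then have a: "a = c *\<^sub>R b" using ip_eq_zero[of "a - c *\<^sub>R b"] assms by (auto simp: c_def)
  then have "ip a a = c * c" using assms by (simp add: ip_linear)
  with assms(3) have "c * c = 1" by simp
  with a show ?thesis using assms by (simp add: reflect_def ip_linear algebra_simps)
qed

text \<open>Two negative numbers that are at most \<open>A x + B y < 0\<close> have a product of at least \<open>(A x + B y)\<^sup>2\<close>, and
  that square is at least \<open>4 (A x) (B y)\<close>.\<close>
lemma peak_inequality:
  fixes A B x y c :: real
  assumes "A * x < 0" "B * y \<le> 0" "2 * A * c * y \<le> A * x + B * y" "2 * B * c * x \<le> A * x + B * y"
  shows "1 \<le> c\<^sup>2"
proof -
  have neg: "A * x + B * y < 0" using assms by linarith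
  have "(- (A * x + B * y)) * (- (A * x + B * y)) \<le> (- (2 * A * c * y)) * (- (2 * B * c * x))"
    using assms(3,4) neg by (intro mult_mono) auto
  then have *: "(A * x + B * y)\<^sup>2 \<le> 4 * c\<^sup>2 * ((A * x) * (B * y))"
    by (simp add: power2_eq_square algebra_simps)
  have pos: "(A * x) * (B * y) > 0"
  proof -
    have "(A * x) * (B * y) \<ge> 0" using assms(1,2) by (simp add: mult_nonpos_nonpos)
    moreover have "(A * x) * (B * y) \<noteq> 0"
    proof
      assume "(A * x) * (B * y) = 0"
      then have "(A * x + B * y)\<^sup>2 \<le> 0" using * by (simp only: mult_zero_right)
      with neg show False by simp
    qed
    ultimately show ?thesis by linarith
  qed
  have "4 * ((A * x) * (B * y)) \<le> (A * x + B * y)\<^sup>2"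
    using zero_le_power2[of "A * x - B * y"] by (simp add: power2_eq_square algebra_simps)
  with * have "4 * ((A * x) * (B * y)) * 1 \<le> 4 * ((A * x) * (B * y)) * c\<^sup>2" by (simp add: algebra_simps)
  with pos show ?thesis by (simp only: mult_le_cancel_left_pos)
qed

text \<open>This is the local step of the path argument.  The path \<open>p, q = a p, b q\<close> descends first and does not
  descend afterwards.  The two Hurwitz moves replace the middle point \<open>q\<close> by \<open>b p\<close> and by \<open>a b q\<close>.  If
  neither of these is higher than \<open>q\<close>, the two roots are parallel.\<close>
lemma peak_lowering:
  assumes V: "a \<in> V" "b \<in> V" "p \<in> V" "h \<in> V" and unit: "ip a a = 1" "ip b b = 1"
    and up: "ip h (reflect a p) < ip h p"
    and nonup: "ip h (reflect a p) \<le> ip h (reflect b (reflect a p))"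
    and opt1: "ip h (reflect b p) \<le> ip h (reflect a p)"
    and opt2: "ip h (reflect a (reflect b (reflect a p))) \<le> ip h (reflect a p)"
  shows "1 \<le> (ip a b)\<^sup>2"
proof -
  define q where "q = reflect a p"
  have q: "q \<in> V" and p: "p = reflect a q" using V unit by (simp_all add: q_def reflect_invol)
  define A B x y c where "A = ip q a" "B = ip q b" "x = ip h a" "y = ip h b" "c = ip a b"
  then have e: "ip q a = A" "ip q b = B" "ip h a = x" "ip h b = y" "ip a b = c" "ip b a = c"
    using V ip_sym[of b a] by simp_all
  have p': "p = q - (2 * A) *\<^sub>R a" using p by (simp add: reflect_def e)
  have bq: "reflect b q = q - (2 * B) *\<^sub>R b" by (simp add: reflect_def e)
  have bp: "reflect b p = q - (2 * A) *\<^sub>R a - (2 * (B - 2 * A * c)) *\<^sub>R b"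
    using V q by (simp add: p' reflect_def ip_linear e)
  have abq: "reflect a (reflect b q) = q - (2 * B) *\<^sub>R b - (2 * (A - 2 * B * c)) *\<^sub>R a"
    using V q by (simp add: bq) (simp add: reflect_def ip_linear e)
  \<comment> \<open>In these coordinates the four heights turn into the hypotheses of the inequality.\<close>
  have 1: "ip h p = ip h q - 2 * (A * x)" using V q by (simp add: p' ip_linear e)
  have 2: "ip h (reflect b q) = ip h q - 2 * (B * y)" using V q by (simp add: bq ip_linear e)
  have 3: "ip h (reflect b p) = ip h q - 2 * (A * x) - 2 * (B * y) + 2 * (2 * A * c * y)"
    using V q by (simp add: bp ip_linear e) (simp add: algebra_simps)
  have 4: "ip h (reflect a (reflect b q)) = ip h q - 2 * (A * x) - 2 * (B * y) + 2 * (2 * B * c * x)"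
    using V q by (simp add: abq ip_linear e) (simp add: algebra_simps)
  note h = up nonup opt1 opt2
  have h': "ip h q < ip h p" "ip h q \<le> ip h (reflect b q)" "ip h (reflect b p) \<le> ip h q"
    "ip h (reflect a (reflect b q)) \<le> ip h q"
    using h unfolding q_def by blast+
  have "1 \<le> c\<^sup>2"
    by (rule peak_inequality[of A x B y]) (use h' in \<open>unfold 1 2 3 4, linarith+\<close>)
  then show ?thesis by (simp add: e)
qed

end

section \<open>Square factors from linearly dependent roots\<close>

text \<open>Independence of a family rather than of a set: repeated vectors make a list dependent.\<close>
fun indep_list :: "'v::real_vector list \<Rightarrow> bool" where
  "indep_list [] = True"
| "indep_list (x # xs) = (x \<notin> span (set xs) \<and> indep_list xs)"

lemma indep_list_independent: "indep_list xs \<Longrightarrow> independent (set xs) \<and> distinct xs"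
  by (induction xs) (auto simp: independent_insert real_vector.independent_empty intro: span_base)

text \<open>Reading from the right, stop at the first vector in the span of its successors.\<close>
lemma not_indep_list_split:
  "\<not> indep_list xs \<Longrightarrow> \<exists>us x vs. xs = us @ x # vs \<and> indep_list vs \<and> x \<in> span (set vs)"
proof (induction xs)
  case (Cons x xs)
  show ?case
  proof (cases "indep_list xs")
    case True
    with Cons.prems have "x # xs = [] @ x # xs \<and> indep_list xs \<and> x \<in> span (set xs)" by simp
    then show ?thesis by blast
  next
    case False
    then obtain us y vs where "xs = us @ y # vs" "indep_list vs" "y \<in> span (set vs)"
      using Cons.IH by blast
    then have "x # xs = (x # us) @ y # vs \<and> indep_list vs \<and> y \<in> span (set vs)" by simp
    then show ?thesis by blast
  qed
qed simp

text \<open>A group acting on a Euclidean space in such a way that the elements of a finite conjugation-invariant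
  set \<open>T\<close> act as reflections and are determined by this action.  Everything that relates
  Hurwitz moves to linear algebra takes place in this setting.\<close>
locale reflection_action = group G + euclidean_form V ip
  for G :: "('a, 'b) monoid_scheme" (structure)
    and V :: "'v::real_vector set" and ip :: "'v \<Rightarrow> 'v \<Rightarrow> real" +
  fixes T :: "'a set" and rho :: "'a \<Rightarrow> 'v \<Rightarrow> 'v" and root :: "'a \<Rightarrow> 'v"
  assumes finite_T: "finite T" and conj_T: "conj_closed T"
    and involution: "t \<in> T \<Longrightarrow> t \<otimes> t = \<one>"
    and rho_mult: "g \<in> carrier G \<Longrightarrow> h \<in> carrier G \<Longrightarrow> v \<in> V \<Longrightarrow> rho (g \<otimes> h) v = rho g (rho h v)"
    and rho_one: "v \<in> V \<Longrightarrow> rho \<one> v = v"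
    and root_V: "t \<in> T \<Longrightarrow> root t \<in> V" and root_unit: "t \<in> T \<Longrightarrow> ip (root t) (root t) = 1"
    and rho_reflect: "t \<in> T \<Longrightarrow> v \<in> V \<Longrightarrow> rho t v = reflect (root t) v"
    and faithful: "s \<in> T \<Longrightarrow> t \<in> T \<Longrightarrow> (\<And>v. v \<in> V \<Longrightarrow> rho s v = rho t v) \<Longrightarrow> s = t"
begin

lemma T_carrier: "T \<subseteq> carrier G"
  using conj_T by (simp add: conj_closed_def)

lemma T_inv: "t \<in> T \<Longrightarrow> inv t = t"
  using T_carrier involution by (intro inv_equality) auto

abbreviation act :: "'a list \<Rightarrow> 'v \<Rightarrow> 'v" where "act xs v \<equiv> foldr rho xs v"

lemma act_refl_list:
  assumes "set xs \<subseteq> T" "v \<in> V"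
  shows "act xs v = foldr (\<lambda>t. reflect (root t)) xs v \<and> act xs v \<in> V"
  using assms by (induction xs) (auto simp: rho_reflect root_V)

lemma act_V [simp]: "set xs \<subseteq> T \<Longrightarrow> v \<in> V \<Longrightarrow> act xs v \<in> V"
  using act_refl_list by blast

lemma act_prod:
  assumes "set xs \<subseteq> T" "v \<in> V"
  shows "act xs v = rho (foldr (\<otimes>) xs \<one>) v"
  using assms
proof (induction xs)
  case (Cons x xs)
  then have "set xs \<subseteq> carrier G" "x \<in> carrier G" using T_carrier by auto
  with Cons show ?case by (simp add: rho_mult)
qed (simp add: rho_one)

lemma act_hurwitz:
  assumes "hurwitz_equiv G xs ys" "set xs \<subseteq> T" "v \<in> V"
  shows "act ys v = act xs v"
  using assms T_carrier hurwitz_equiv_prod[of xs ys]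
    hurwitz_equiv_conj_closed[OF assms(1) conj_T] act_prod[of xs v] act_prod[of ys v]
  by auto

lemma act_isometry:
  assumes "set xs \<subseteq> T" "v \<in> V" "w \<in> V"
  shows "ip (act xs v) (act xs w) = ip v w"
  using assms by (induction xs) (auto simp: rho_reflect root_V root_unit reflect_isometry)

lemma act_add:
  assumes "set xs \<subseteq> T" "v \<in> V" "w \<in> V"
  shows "act xs (v + w) = act xs v + act xs w"
  using assms by (induction xs) (auto simp: rho_reflect root_V root_unit reflect_add)

lemma act_fixed:
  assumes "set xs \<subseteq> T" "v \<in> V" "\<And>t. t \<in> set xs \<Longrightarrow> ip v (root t) = 0"
  shows "act xs v = v"
  using assms by (induction xs) (auto simp: rho_reflect root_V root_unit reflect_eq_self_iff)

text \<open>The total height, measured by \<open>ip v\<close>, of the path that \<open>v\<close> runs through when the letters are applied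
  from right to left.  The starting point \<open>v\<close> is common to all paths and is left out.\<close>
fun height_sum :: "'v \<Rightarrow> 'a list \<Rightarrow> real" where
  "height_sum v [] = 0"
| "height_sum v (x # xs) = ip v (act (x # xs) v) + height_sum v xs"

lemma height_sum_append_cong:
  assumes "act xs v = act ys v"
  shows "height_sum v (us @ xs) - height_sum v xs = height_sum v (us @ ys) - height_sum v ys"
  using assms by (induction us) auto

definition has_square :: "'a list \<Rightarrow> bool" where
  "has_square xs \<longleftrightarrow> (\<exists>us q vs. xs = us @ [q, q] @ vs)"

text \<open>A Hurwitz move at the letters \<open>b, a\<close> changes only one point of the path, so maximality of the total
  height bounds the two candidates for this point, and \<open>peak_lowering\<close> applies.\<close>
lemma maximal_descent_continues:
  assumes T: "set (us @ [b, a] @ vs) \<subseteq> T" and v: "v \<in> V" and ne: "a \<noteq> b"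
    and max: "\<And>ys. hurwitz_equiv G (us @ [b, a] @ vs) ys \<Longrightarrow>
                height_sum v ys \<le> height_sum v (us @ [b, a] @ vs)"
    and down: "ip v (act (a # vs) v) < ip v (act vs v)"
  shows "ip v (act (b # a # vs) v) < ip v (act (a # vs) v)"
proof (rule ccontr)
  assume ndown: "\<not> ?thesis"
  define p where "p = act vs v"
  have ab: "a \<in> T" "b \<in> T" "a \<in> carrier G" "b \<in> carrier G" and vs: "set vs \<subseteq> T" and p: "p \<in> V"
    using T v T_carrier by (auto simp: p_def)
  have conj: "rho (a \<otimes> b \<otimes> a) p = rho a (rho b (rho a p))"
    if "a \<in> T" "b \<in> T" for a b
  proof -
    have "a \<in> carrier G" "b \<in> carrier G" using that T_carrier by auto
    moreover have "rho a p \<in> V" using that p by (simp add: rho_reflect root_V)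
    ultimately show ?thesis using p by (simp add: rho_mult m_assoc)
  qed
  have e1: "hurwitz_equiv G (us @ [b, a] @ vs) (us @ [a, a \<otimes> b \<otimes> a] @ vs)"
    using hurwitz_move_imp_equiv[OF hurwitz_move.sigma[of G us b a vs]] T_inv ab by simp
  have e2: "hurwitz_equiv G (us @ [b, a] @ vs) (us @ [b \<otimes> a \<otimes> b, b] @ vs)"
    using hurwitz_move_imp_equiv[OF hurwitz_move.sigma_inv[of G us b a vs]] T_inv ab by simp
  have tail: "act [b, a] p = act [x, y] p \<Longrightarrow> hurwitz_equiv G (us @ [b, a] @ vs) (us @ [x, y] @ vs) \<Longrightarrow>
       ip v (rho y p) \<le> ip v (rho a p)" for x y
    using max[of "us @ [x, y] @ vs"] height_sum_append_cong[of "[b, a] @ vs" v "[x, y] @ vs" us]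
    by (simp flip: p_def)
  have rV: "rho x w \<in> V" and invol: "rho x (rho x w) = w" if "x \<in> T" "w \<in> V" for x w
    using that by (simp_all add: rho_reflect root_V root_unit reflect_invol)
  have aab: "act [a, a \<otimes> b \<otimes> a] p = act [b, a] p"
    using conj[OF ab(1,2)] invol[OF ab(1) rV[OF ab(2) rV[OF ab(1) p]]] by simp
  have bab: "act [b \<otimes> a \<otimes> b, b] p = act [b, a] p"
  proof -
    have "rho (b \<otimes> a \<otimes> b) (rho b p) = rho b (rho a (rho b (rho b p)))"
      using ab rV p by (simp add: rho_mult m_assoc)
    then show ?thesis using invol[OF ab(2) p] by simp
  qed
  have o1: "ip v (reflect (root a) (reflect (root b) (reflect (root a) p))) \<le> ip v (reflect (root a) p)"
    using tail[OF aab[symmetric] e1] conj[OF ab(1,2)] ab p by (simp add: rho_reflect root_V)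
  have o2: "ip v (reflect (root b) p) \<le> ip v (reflect (root a) p)"
    using tail[OF bab[symmetric] e2] ab p by (simp add: rho_reflect root_V)
  have "1 \<le> (ip (root a) (root b))\<^sup>2"
    using down ndown ab p v
    by (intro peak_lowering[OF _ _ p v _ _ _ _ o2 o1])
       (auto simp: rho_reflect root_V root_unit simp flip: p_def)
  then have "reflect (root a) w = reflect (root b) w" if "w \<in> V" for w
    using unit_parallel[OF _ _ _ _ _ that] ab by (simp add: root_V root_unit)
  then have "a = b" using ab by (intro faithful) (auto simp: rho_reflect)
  with ne show False by simp
qed

text \<open>The path of \<open>v\<close> is closed.  In a tuple of maximal total height without equal neighbours, a path that
  leaves the top \<open>v\<close> descends forever, so it never leaves \<open>v\<close> and every factor fixes \<open>v\<close>.\<close>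
lemma fixed_product_square:
  assumes T: "set xs \<subseteq> T" and v: "v \<in> V" and stays: "act xs v = v"
    and moved: "x \<in> set xs" "rho x v \<noteq> v"
  shows "\<exists>ys. hurwitz_equiv G xs ys \<and> has_square ys"
proof (rule ccontr)
  assume nosq: "\<not> ?thesis"
  define orb where "orb = {ys. hurwitz_equiv G xs ys}"
  have "orb \<subseteq> {ys. set ys \<subseteq> T \<and> length ys = length xs}"
    using hurwitz_equiv_conj_closed[OF _ conj_T T] hurwitz_equiv_length by (auto simp: orb_def)
  then have fin: "finite orb" using finite_lists_length_eq[OF finite_T] finite_subset by blast
  have "xs \<in> orb" by (simp add: orb_def)
  then have ne: "height_sum v ` orb \<noteq> {}" by blast
  have fi: "finite (height_sum v ` orb)" using fin by simp
  obtain l where l: "l \<in> orb" "Max (height_sum v ` orb) = height_sum v l"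
    using Max_in[OF fi ne] by blast
  then have max: "height_sum v ys \<le> height_sum v l" if "ys \<in> orb" for ys
    using Max_ge[OF fi, of "height_sum v ys"] that by simp
  have lT: "set l \<subseteq> T" and lx: "hurwitz_equiv G xs l"
    using l(1) hurwitz_equiv_conj_closed[OF _ conj_T T, of l] by (simp_all add: orb_def)
  have lfix: "act l v = v" using act_hurwitz[OF lx T v] stays by simp
  have lmax: "height_sum v ys \<le> height_sum v l" if "hurwitz_equiv G l ys" for ys
    using max hurwitz_equiv_trans[OF lx that] by (simp add: orb_def)
  \<comment> \<open>\<open>v\<close> is the unique highest point of its orbit, as all points of the orbit have the same norm.\<close>
  have top: "ip v (act vs v) \<le> ip v v \<and> (ip v (act vs v) = ip v v \<longrightarrow> act vs v = v)"
    if "set vs \<subseteq> T" for vs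
  proof -
    let ?w = "act vs v"
    have w: "?w \<in> V" "ip ?w ?w = ip v v" using that v act_isometry[OF that v v] by simp_all
    have "ip (v - ?w) (v - ?w) = 2 * (ip v v - ip v ?w)"
      using w v ip_sym[of ?w v] by (simp add: ip_linear)
    moreover have "ip (v - ?w) (v - ?w) \<ge> 0" "v - ?w \<noteq> 0 \<longrightarrow> ip (v - ?w) (v - ?w) > 0"
      using ip_pos[of "v - ?w"] w v by (cases "v - ?w = 0"; force)+
    ultimately show ?thesis by auto
  qed
  have key: "(\<forall>t\<in>set ws. rho t v = v) \<or> (\<exists>a vs. ws = a # vs \<and> ip v (act ws v) < ip v (act vs v))"
    if "l = us @ ws" for us ws
    using that
  proof (induction ws arbitrary: us)
    case (Cons b ws)
    have wsT: "set ws \<subseteq> T" "b \<in> T" using Cons.prems lT by auto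
    from Cons.IH[of "us @ [b]"] Cons.prems consider "\<forall>t\<in>set ws. rho t v = v"
      | a vs where "ws = a # vs" "ip v (act ws v) < ip v (act vs v)" by auto
    then show ?case
    proof cases
      case 1
      have e: "act ws v = v" using 1 by (induction ws) auto
      show ?thesis
        using top[of "b # ws"] wsT e 1 by auto
    next
      case 2
      have "a \<noteq> b"
        using nosq lx Cons.prems 2(1) unfolding has_square_def by (metis append_Cons append_Nil)
      then have "ip v (act (b # a # vs) v) < ip v (act (a # vs) v)"
        using maximal_descent_continues[of us b a vs v] lT v 2 lmax Cons.prems by auto
      with 2 show ?thesis by auto
    qed
  qed simp
  from key[of "[]" l] consider "\<forall>t\<in>set l. rho t v = v"
    | a vs where "l = a # vs" "ip v (act l v) < ip v (act vs v)" by auto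
  then show False
  proof cases
    case 1
    \<comment> \<open>Hurwitz moves do not change the generated group, so the factors of the original list stabilise \<open>v\<close> as well.\<close>
    let ?H = "{g \<in> carrier G. rho g v = v}"
    have "subgroup ?H G"
    proof (rule subgroupI)
      show "inv a \<in> ?H" if "a \<in> ?H" for a
      proof -
        have "rho (inv a) v = rho (inv a) (rho a v)" using that by simp
        also have "\<dots> = v" using that v rho_mult[of "inv a" a v] by (simp add: rho_one)
        finally show ?thesis using that by simp
      qed
    next
      have "\<one> \<in> ?H" using v by (simp add: rho_one)
      then show "?H \<noteq> {}" by blast
    qed (use v in \<open>auto simp: rho_mult\<close>)
    moreover have "set l \<subseteq> ?H" using 1 lT T_carrier by auto
    ultimately have "set xs \<subseteq> ?H"
      using hurwitz_equiv_subgroup[OF hurwitz_equiv_sym[OF lx]] T T_carrier by blast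
    with moved show False by auto
  next
    case 2
    then show False using top[of vs] lT lfix by auto
  qed
qed

text \<open>The image of \<open>1 - t\<^sub>1 \<dots> t\<^sub>k\<close> is the whole span of independent roots (Carter).  In the induction step a
  vector \<open>w\<close> that solves the equation modulo the first root is corrected by a multiple of a vector \<open>z\<close>
  which is invisible to the other roots.\<close>
lemma one_minus_product_surjective:
  assumes "set xs \<subseteq> T" "indep_list (map root xs)" "\<beta> \<in> span (root ` set xs)"
  shows "\<exists>v\<in>V. v - act xs v = \<beta>"
  using assms
proof (induction xs arbitrary: \<beta>)
  case (Cons a xs)
  let ?A = "root ` set xs" and ?a = "root a"
  have A: "finite ?A" "?A \<subseteq> V" "?a \<in> V" "a \<in> T" "ip ?a ?a = 1" "set xs \<subseteq> T"
    using Cons.prems root_V root_unit by auto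
  obtain k where k: "\<beta> - k *\<^sub>R ?a \<in> span ?A"
    using Cons.prems(3) span_breakdown_eq[of \<beta> ?a ?A] by auto
  then obtain w where w: "w \<in> V" "w - act xs w = \<beta> - k *\<^sub>R ?a"
    using Cons.IH Cons.prems by auto
  obtain z where z: "z \<in> V" "\<forall>x\<in>?A. ip z x = 0" "ip z ?a \<noteq> 0"
    using separating_vector[OF A(1-3)] Cons.prems(2) by auto
  define c where "c = (k / 2 - ip (act xs w) ?a) / ip z ?a"
  define v where "v = w + c *\<^sub>R z"
  have cz: "act xs (c *\<^sub>R z) = c *\<^sub>R z"
    using z A root_V by (intro act_fixed) (auto simp: ip_linear)
  have av: "act xs v = act xs w + c *\<^sub>R z"
    using w z A cz by (simp add: v_def act_add)
  have aV: "act xs v \<in> V" "act xs w \<in> V" "v \<in> V" using A w z by (auto simp: v_def)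
  have "ip (act xs v) ?a = k / 2"
    using z w A aV by (simp add: av ip_linear c_def)
  then have "act (a # xs) v = act xs v - k *\<^sub>R ?a"
    using A aV by (simp add: rho_reflect reflect_def)
  then have "v - act (a # xs) v = v - act xs v + k *\<^sub>R ?a"
    by (simp only:) (simp add: algebra_simps)
  then have "v - act (a # xs) v = (w - act xs w) + k *\<^sub>R ?a"
    unfolding av by (simp add: v_def)
  then have "v - act (a # xs) v = \<beta>" using w(2) by simp
  with aV show ?case by blast
qed auto

text \<open>Let the root \<open>b\<close> of \<open>x\<close> lie in the span of the independent roots of \<open>vs\<close>, and take \<open>v\<close> with
  \<open>v - w = b\<close>, where \<open>w\<close> is the image of \<open>v\<close> under the product of \<open>vs\<close>.  As \<open>v\<close> and \<open>w\<close> have the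
  same norm and differ by \<open>b\<close>, \<open>x\<close> exchanges them, and the product \<open>x vs\<close> fixes \<open>v\<close> while \<open>x\<close>
  moves it.\<close>
lemma dependent_square:
  assumes T: "set xs \<subseteq> T" and dep: "\<not> indep_list (map root xs)"
  shows "\<exists>us q vs. hurwitz_equiv G xs (us @ [q, q] @ vs)"
proof -
  obtain ls r rs where lr: "map root xs = ls @ r # rs" "indep_list rs" "r \<in> span (set rs)"
    using not_indep_list_split[OF dep] by blast
  obtain us ws where xs1: "xs = us @ ws" "r # rs = map root ws"
    using lr(1) by (auto simp: map_eq_append_conv)
  obtain x vs where ws: "ws = x # vs" "r = root x" "rs = map root vs"
    using xs1(2) by (auto simp: Cons_eq_map_conv)
  have xs: "xs = us @ x # vs" and vs: "indep_list (map root vs)" "root x \<in> span (root ` set vs)"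
    using xs1(1) ws lr by simp_all
  have xT: "x \<in> T" "set vs \<subseteq> T" using T xs by auto
  let ?b = "root x"
  have b: "?b \<in> V" "ip ?b ?b = 1" using xT root_V root_unit by auto
  obtain v where v: "v \<in> V" "v - act vs v = ?b"
    using one_minus_product_surjective[OF xT(2) vs] by blast
  let ?w = "act vs v"
  have w: "?w \<in> V" "ip ?w ?w = ip v v" "?w = v - ?b"
    using v xT act_isometry[OF xT(2) v(1) v(1)] by (auto simp: algebra_simps)
  have "ip (v - ?b) (v - ?b) = ip v v - 2 * ip v ?b + 1"
    using v b ip_sym[of ?b v] by (simp add: ip_linear)
  then have vb: "2 * ip v ?b = 1" using w by simp
  have xv: "rho x v = v - ?b" using xT v vb by (simp add: rho_reflect reflect_def)
  have "rho x (rho x v) = v" using xT v b by (simp add: rho_reflect reflect_invol)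
  then have stays: "act (x # vs) v = v" using xv w(3) by simp
  have "?b \<noteq> 0" using b ip_scale_left[of ?b ?b 0] by auto
  then have mv: "rho x v \<noteq> v" by (simp add: xv)
  obtain ys where "hurwitz_equiv G (x # vs) ys" "has_square ys"
    using fixed_product_square[OF _ v(1) stays _ mv] xT by auto
  then obtain ls q rs where "hurwitz_equiv G (x # vs) (ls @ [q, q] @ rs)"
    by (auto simp: has_square_def)
  from hurwitz_equiv_append[OF this, of us "[]"]
  have "hurwitz_equiv G xs ((us @ ls) @ [q, q] @ rs)" by (simp add: xs)
  then show ?thesis by blast
qed

end

section \<open>Dihedral relations and words in the simple reflections\<close>

text \<open>The dimension of the representation is the number of simple reflections.  Vectors are
  therefore coordinate functions on the whole type, and a finite set of indices bounds their support.\<close>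
instantiation "fun" :: (type, scaleR) scaleR
begin
definition scaleR_fun :: "real \<Rightarrow> ('a \<Rightarrow> 'b) \<Rightarrow> 'a \<Rightarrow> 'b" where
  "scaleR_fun c f = (\<lambda>x. c *\<^sub>R f x)"
instance ..
end

instance "fun" :: (type, real_vector) real_vector
  by standard (auto simp: scaleR_fun_def fun_eq_iff scaleR_add_left scaleR_add_right)

fun alternating :: "nat \<Rightarrow> 'a \<Rightarrow> 'a \<Rightarrow> 'a list" where
  "alternating 0 x y = []"
| "alternating (Suc n) x y = x # alternating n y x"

lemma set_alternating: "set (alternating n x y) \<subseteq> {x, y}"
  by (induction n arbitrary: x y) auto

lemma length_alternating [simp]: "length (alternating n x y) = n"
  by (induction n arbitrary: x y) auto

lemma alternating_double: "alternating (2 * n) x y = concat (replicate n [x, y])"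
  by (induction n) auto

lemma map_alternating: "map f (alternating n x y) = alternating n (f x) (f y)"
  by (induction n arbitrary: x y) auto

lemma alternating_append:
  "alternating (k + n) x y = alternating k x y @ (if even k then alternating n x y else alternating n y x)"
  by (induction k arbitrary: x y) auto

context symmetric_form
begin

lemma reflect_scale: "a \<in> V \<Longrightarrow> v \<in> V \<Longrightarrow> reflect a (c *\<^sub>R v) = c *\<^sub>R reflect a v"
  by (simp add: reflect_def ip_linear algebra_simps)

lemma fold_reflect_linear:
  assumes "set xs \<subseteq> V" "v \<in> V" "w \<in> V"
  shows "fold reflect xs (v + w) = fold reflect xs v + fold reflect xs w"
    "fold reflect xs (c *\<^sub>R v) = c *\<^sub>R fold reflect xs v"
  using assms by (induction xs arbitrary: v w) (auto simp: reflect_add reflect_scale)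

lemma fold_reflect_fixed:
  assumes "set xs \<subseteq> V" "v \<in> V" "\<And>x. x \<in> set xs \<Longrightarrow> ip v x = 0"
  shows "fold reflect xs v = v"
  using assms by (induction xs) (auto simp: reflect_def)

lemma reflect_plane:
  assumes "a \<in> V" "b \<in> V" "ip b b = 1" "ip a b = - cos \<theta>"
  shows "reflect b (x *\<^sub>R a + y *\<^sub>R b) = x *\<^sub>R a + (2 * cos \<theta> * x - y) *\<^sub>R b"
proof -
  have "reflect b (x *\<^sub>R a + y *\<^sub>R b) = x *\<^sub>R a + y *\<^sub>R b - (2 * (y - cos \<theta> * x)) *\<^sub>R b"
    using assms by (simp add: reflect_def ip_linear)
  also have "\<dots> = x *\<^sub>R a + (y - 2 * (y - cos \<theta> * x)) *\<^sub>R b"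
    by (simp only: scaleR_left_diff_distrib[of y] add_diff_eq)
  also have "y - 2 * (y - cos \<theta> * x) = 2 * cos \<theta> * x - y" by simp
  finally show ?thesis .
qed

text \<open>The recursion \<open>sin (\<psi> + \<theta>) + sin (\<psi> - \<theta>) = 2 cos \<theta> sin \<psi>\<close> makes every reflection advance the angle by
  \<open>\<theta>\<close>.  The same formula yields the dihedral relation (after \<open>2 m\<close> steps) and the positivity of the
  coefficients as long as the angle stays below \<open>\<pi>\<close>.\<close>
lemma fold_reflect_alternating:
  assumes "a \<in> V" "b \<in> V" "ip a a = 1" "ip b b = 1" "ip a b = - cos \<theta>"
  shows "fold reflect (alternating k b a) (sin (\<phi> + \<theta>) *\<^sub>R a + sin \<phi> *\<^sub>R b) =
    (if even k then sin (\<phi> + real (k + 1) * \<theta>) *\<^sub>R a + sin (\<phi> + real k * \<theta>) *\<^sub>R b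
     else sin (\<phi> + real (k + 1) * \<theta>) *\<^sub>R b + sin (\<phi> + real k * \<theta>) *\<^sub>R a)"
  using assms
proof (induction k arbitrary: a b \<phi>)
  case (Suc k)
  have "2 * cos \<theta> * sin (\<phi> + \<theta>) - sin \<phi> = sin ((\<phi> + \<theta>) + \<theta>)"
  proof -
    have "sin ((\<phi> + \<theta>) + \<theta>) + sin ((\<phi> + \<theta>) - \<theta>) = 2 * cos \<theta> * sin (\<phi> + \<theta>)"
      unfolding sin_add[of "\<phi> + \<theta>" \<theta>] sin_diff[of "\<phi> + \<theta>" \<theta>] by simp
    then show ?thesis by simp
  qed
  then have "reflect b (sin (\<phi> + \<theta>) *\<^sub>R a + sin \<phi> *\<^sub>R b) =
      sin ((\<phi> + \<theta>) + \<theta>) *\<^sub>R b + sin (\<phi> + \<theta>) *\<^sub>R a"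
    unfolding reflect_plane[OF Suc.prems(1,2,4,5)] by (simp only: add.commute)
  moreover have "ip b a = - cos \<theta>" using Suc.prems ip_sym by simp
  moreover have "(\<phi> + \<theta>) + real (k + 1) * \<theta> = \<phi> + real (Suc k + 1) * \<theta>"
     "(\<phi> + \<theta>) + real k * \<theta> = \<phi> + real (Suc k) * \<theta>"
    by (simp_all add: algebra_simps)
  ultimately show ?case
    using Suc.IH[of b a "\<phi> + \<theta>"] Suc.prems
    by (simp only: alternating.simps fold_Cons comp_def even_Suc if_not_P simp_thms split: if_split) argo
qed (simp add: add.commute)

text \<open>The composition of the reflections fixes \<open>a\<close> and \<open>b\<close> by periodicity of the sine and fixes the
  orthogonal complement of their plane; every \<open>v\<close> is the sum of a vector of either kind.\<close>
lemma dihedral_relation: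
  assumes V: "a \<in> V" "b \<in> V" "ip a a = 1" "ip b b = 1" "ip a b = - cos \<theta>"
    and \<theta>: "real m * \<theta> = pi" "sin \<theta> \<noteq> 0" and v: "v \<in> V"
  shows "fold reflect (alternating (2 * m) b a) v = v"
proof -
  let ?R = "fold reflect (alternating (2 * m) b a)"
  have set: "set (alternating (2 * m) b a) \<subseteq> V" using set_alternating[of "2 * m" b a] V by auto
  have per: "sin (\<phi> + real (2 * m + 1) * \<theta>) = sin (\<phi> + \<theta>)" "sin (\<phi> + real (2 * m) * \<theta>) = sin \<phi>" for \<phi>
  proof -
    have "real (2 * m) * \<theta> = 2 * pi" using \<theta>(1) by simp
    moreover have "real (2 * m + 1) * \<theta> = 2 * pi + \<theta>" using \<theta>(1) by (simp add: algebra_simps)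
    moreover have "\<phi> + (2 * pi + \<theta>) = (\<phi> + \<theta>) + 2 * pi" by simp
    ultimately show "sin (\<phi> + real (2 * m + 1) * \<theta>) = sin (\<phi> + \<theta>)" "sin (\<phi> + real (2 * m) * \<theta>) = sin \<phi>"
      by (simp_all only: sin_periodic)
  qed
  have fix1: "?R (sin (\<phi> + \<theta>) *\<^sub>R a + sin \<phi> *\<^sub>R b) = sin (\<phi> + \<theta>) *\<^sub>R a + sin \<phi> *\<^sub>R b" for \<phi>
    using fold_reflect_alternating[OF V, of "2 * m" \<phi>] per by simp
  have "?R (sin \<theta> *\<^sub>R a) = sin \<theta> *\<^sub>R a" "?R ((- sin \<theta>) *\<^sub>R b) = (- sin \<theta>) *\<^sub>R b"
    using fix1[of 0] fix1[of "- \<theta>"] by simp_all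
  then have "sin \<theta> *\<^sub>R ?R a = sin \<theta> *\<^sub>R a" "(- sin \<theta>) *\<^sub>R ?R b = (- sin \<theta>) *\<^sub>R b"
    using fold_reflect_linear(2)[OF set V(1) V(1)] fold_reflect_linear(2)[OF set V(2) V(2)]
    by (simp_all only:)
  then have ab: "?R a = a" "?R b = b" using \<theta>(2) by simp_all
  \<comment> \<open>\<open>x a + y b\<close> is the projection of \<open>v\<close> to the plane of \<open>a\<close> and \<open>b\<close>.\<close>
  define d x y where "d = (sin \<theta>)\<^sup>2" and "x = (ip v a + cos \<theta> * ip v b) / d" 
    and "y = (ip v b + cos \<theta> * ip v a) / d"
  have d: "d \<noteq> 0" "d = 1 - (cos \<theta>)\<^sup>2" using \<theta>(2) unfolding d_def by (simp, simp only: sin_squared_eq)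
  have "x - cos \<theta> * y = (ip v a * (1 - (cos \<theta>)\<^sup>2)) / d" "y - cos \<theta> * x = (ip v b * (1 - (cos \<theta>)\<^sup>2)) / d"
    by (simp_all add: x_def y_def power2_eq_square flip: diff_divide_distrib) (simp_all add: algebra_simps)
  then have xy: "x - cos \<theta> * y = ip v a" "y - cos \<theta> * x = ip v b" using d by simp_all
  define w where "w = v - (x *\<^sub>R a + y *\<^sub>R b)"
  have ba: "ip b a = - cos \<theta>" using V ip_sym by simp
  have w: "w \<in> V" "ip w a = 0" "ip w b = 0"
    using V v ba xy by (simp_all add: w_def ip_linear mult.commute)
  have "?R w = w"
    using w set_alternating[of "2 * m" b a] by (intro fold_reflect_fixed[OF set]) auto
  then have "?R (w + (x *\<^sub>R a + y *\<^sub>R b)) = w + (x *\<^sub>R a + y *\<^sub>R b)"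
    using w V set ab by (simp add: fold_reflect_linear)
  then show ?thesis by (simp add: w_def)
qed

end

locale finite_coxeter_system = group G for G :: "('a, 'b) monoid_scheme" (structure) +
  fixes S :: "'a set"
  assumes coxeter: "coxeter_system G S" and finite_carrier: "finite (carrier G)"
begin

lemma S_carrier: "S \<subseteq> carrier G"
  using coxeter by (simp add: coxeter_system_def)

lemma finite_S: "finite S"
  using finite_subset[OF S_carrier finite_carrier] .

lemma S_invol:
  assumes "s \<in> S"
  shows "s \<otimes> s = \<one>" "inv s = s"
proof -
  have "s [^] (2::nat) = \<one>"
    using coxeter assms S_carrier pow_ord_eq_1[of s] by (auto simp: coxeter_system_def)
  then show *: "s \<otimes> s = \<one>" using assms S_carrier by (auto simp: numeral_2_eq_2)
  show "inv s = s" using * assms S_carrier by (intro inv_equality) auto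
qed

abbreviation word_prod :: "'a list \<Rightarrow> 'a" where "word_prod l \<equiv> foldr (\<otimes>) l \<one>"

lemma word_prod_rev:
  assumes "set l \<subseteq> S"
  shows "word_prod (rev l) = inv (word_prod l)"
  using assms
proof (induction l)
  case (Cons s l)
  then have "set l \<subseteq> carrier G" "s \<in> carrier G" using S_carrier by auto
  with Cons show ?case by (simp add: foldr_mult_append inv_mult_group S_invol del: foldr_append)
qed simp

lemma word_exists:
  assumes "g \<in> carrier G"
  shows "\<exists>l. set l \<subseteq> S \<and> word_prod l = g"
proof -
  have "g \<in> generate G S" using coxeter assms by (simp add: coxeter_system_def has_presentation_def)
  then show ?thesis
  proof (induction rule: generate.induct)
    case one
    show ?case by (intro exI[of _ "[]"]) simp
  next
    case (incl h)
    then show ?case using S_carrier by (intro exI[of _ "[h]"]) auto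
  next
    case (inv h)
    then show ?case using S_carrier S_invol[of h] by (intro exI[of _ "[h]"]) auto
  next
    case (eng g h)
    then obtain k l where "set k \<subseteq> S" "word_prod k = g" "set l \<subseteq> S" "word_prod l = h" by auto
    then show ?case using S_carrier by (intro exI[of _ "k @ l"]) (auto simp: foldr_mult_append simp del: foldr_append)
  qed
qed

text \<open>The universal property of the presentation: any family of maps satisfying the Coxeter
  relations is trivial on words that represent the identity.\<close>
lemma relation_acts_trivially:
  fixes f :: "'a \<Rightarrow> 'c \<Rightarrow> 'c"
  assumes l: "set l \<subseteq> S" "word_prod l = \<one>"
    and sq: "\<And>s x. s \<in> S \<Longrightarrow> f s (f s x) = x"
    and rel: "\<And>s t x. s \<in> S \<Longrightarrow> t \<in> S \<Longrightarrow> foldr f (alternating (2 * ord (s \<otimes> t)) s t) x = x"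
  shows "foldr f l x = x"
proof -
  let ?w = "map (\<lambda>s. (s, True)) l"
  let ?F = "\<lambda>w. foldr f (map fst w)"
  have "eval_gword G ?w = word_prod l"
    by (induction l) (simp_all add: eval_gword_def)
  moreover have "?w \<in> lists (S \<times> UNIV)" using l(1) by auto
  ultimately have "pres_equiv S (coxeter_relators G S) ?w []"
    using l(2) coxeter by (auto simp: coxeter_system_def has_presentation_def)
  moreover have "?F u x = ?F v x" if "pres_equiv S (coxeter_relators G S) u v" for u v x
    using that
  proof (induction arbitrary: x rule: pres_equiv.induct)
    case (relator u v q)
    then obtain s t where q: "s \<in> S" "t \<in> S"
        "q = concat (replicate (ord (s \<otimes> t)) [(s, True), (t, True)])"
      by (auto simp: coxeter_relators_def)
    have "map fst q = alternating (2 * ord (s \<otimes> t)) s t"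
      by (simp add: q(3) map_concat alternating_double)
    with q rel show ?case by simp
  qed (auto simp: sq)
  ultimately show ?thesis by (fastforce simp: comp_def)
qed

lemma word_action_unique:
  fixes f :: "'a \<Rightarrow> 'c \<Rightarrow> 'c"
  assumes l: "set l \<subseteq> S" "set k \<subseteq> S" "word_prod l = word_prod k"
    and sq: "\<And>s x. s \<in> S \<Longrightarrow> f s (f s x) = x"
    and rel: "\<And>s t x. s \<in> S \<Longrightarrow> t \<in> S \<Longrightarrow> foldr f (alternating (2 * ord (s \<otimes> t)) s t) x = x"
  shows "foldr f l x = foldr f k x"
proof -
  have "word_prod (l @ rev k) = \<one>"
    using l S_carrier by (auto simp add: foldr_mult_append word_prod_rev simp del: foldr_append)
  then have "foldr f (l @ rev k) (foldr f k x) = foldr f k x"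
    using l by (intro relation_acts_trivially[OF _ _ sq rel]) auto
  moreover have "foldr f (rev k) (foldr f k x) = x"
    using l(2) by (induction k) (auto simp: sq)
  ultimately show ?thesis by simp
qed

lemma ord_pos: "g \<in> carrier G \<Longrightarrow> ord g \<ge> 1"
  using ord_ge_1[OF finite_carrier] by blast

lemma ord_swap:
  assumes "s \<in> S" "t \<in> S"
  shows "ord (t \<otimes> s) = ord (s \<otimes> t)"
proof -
  have c: "s \<in> carrier G" "t \<in> carrier G" using assms S_carrier by auto
  then have "t \<otimes> s = inv (s \<otimes> t)" using assms by (simp add: S_invol inv_mult_group)
  then show ?thesis using c ord_inv[of "s \<otimes> t"] by simp
qed

lemma ord_ge_2:
  assumes "s \<in> S" "t \<in> S" "s \<noteq> t"
  shows "ord (s \<otimes> t) \<ge> 2"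
proof -
  have c: "s \<in> carrier G" "t \<in> carrier G" using assms S_carrier by auto
  have "ord (s \<otimes> t) \<noteq> 1"
  proof
    assume "ord (s \<otimes> t) = 1"
    then have "s \<otimes> t = \<one>" using c ord_eq_1[of "s \<otimes> t"] by simp
    then have "s = inv t" using c inv_equality by metis
    with assms S_invol show False by simp
  qed
  then show ?thesis using ord_pos[of "s \<otimes> t"] c by simp
qed

end

section \<open>The representation attached to a set of simple reflections\<close>

text \<open>For \<open>J = S\<close> this is the geometric representation.  The general case is a representation of \<open>W\<close> on
  the span of the simple roots in \<open>J\<close> in which the simple reflections outside \<open>J\<close> act trivially; for
  \<open>s \<in> J\<close> and \<open>t \<in> S - J\<close> the Coxeter relation then holds because its exponent is even.\<close>
locale coxeter_representation = finite_coxeter_system +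
  fixes J :: "'a set"
  assumes J_S: "J \<subseteq> S"
    and even_ord: "s \<in> J \<Longrightarrow> t \<in> S \<Longrightarrow> t \<notin> J \<Longrightarrow> even (ord (s \<otimes> t))"
begin

lemma finite_J: "finite J"
  using finite_subset[OF J_S finite_S] .

definition simple_root :: "'a \<Rightarrow> 'a \<Rightarrow> real" where
  "simple_root s = (\<lambda>x. if x = s then 1 else 0)"

definition B :: "('a \<Rightarrow> real) \<Rightarrow> ('a \<Rightarrow> real) \<Rightarrow> real" where
  "B v w = (\<Sum>s\<in>J. \<Sum>t\<in>J. v s * w t * (- cos (pi / real (ord (s \<otimes> t)))))"

lemma B_sym: "B v w = B w v"
proof -
  have "B v w = (\<Sum>t\<in>J. \<Sum>s\<in>J. v s * w t * (- cos (pi / real (ord (s \<otimes> t)))))"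
    unfolding B_def by (rule sum.swap)
  also have "\<dots> = B w v"
    unfolding B_def using J_S ord_swap by (intro sum.cong refl) (auto simp: subset_iff)
  finally show ?thesis .
qed

sublocale B: symmetric_form UNIV B
proof
  show "B x y = B y x" for x y by (rule B_sym)
  show "B (x + y) z = B x z + B y z" "B (c *\<^sub>R x) z = c * B x z" for x y z c
    by (simp_all add: B_def plus_fun_def scaleR_fun_def sum.distrib sum_distrib_left sum_subtractf
        algebra_simps sum_negf)
qed (simp add: subspace_UNIV)

lemma B_simple_root:
  assumes "s \<in> J" "t \<in> J"
  shows "B (simple_root s) (simple_root t) = - cos (pi / real (ord (s \<otimes> t)))"
proof -
  have "B (simple_root s) (simple_root t) =
      (\<Sum>x\<in>J. if x = s then (\<Sum>y\<in>J. if y = t then - cos (pi / real (ord (x \<otimes> y))) else 0) else 0)"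
    unfolding B_def simple_root_def by (intro sum.cong refl) (auto intro!: sum.cong)
  then show ?thesis using assms finite_J by (simp add: sum.delta)
qed

lemma B_simple_root_self: "s \<in> J \<Longrightarrow> B (simple_root s) (simple_root s) = 1"
  using J_S by (auto simp: B_simple_root S_invol)

definition simple_refl :: "'a \<Rightarrow> ('a \<Rightarrow> real) \<Rightarrow> ('a \<Rightarrow> real)" where
  "simple_refl s v = (if s \<in> J then B.reflect (simple_root s) v else v)"

lemma simple_refl_square: "simple_refl s (simple_refl s v) = v"
  by (simp add: simple_refl_def B.reflect_invol B_simple_root_self)

lemma dihedral_angle:
  assumes "s \<in> S" "t \<in> S" "s \<noteq> t"
  shows "0 < pi / real (ord (s \<otimes> t))" "pi / real (ord (s \<otimes> t)) < pi"
    "real (ord (s \<otimes> t)) * (pi / real (ord (s \<otimes> t))) = pi"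
  using ord_ge_2[OF assms] by (simp_all add: field_simps)

lemma simple_refl_relation:
  assumes "s \<in> S" "t \<in> S"
  shows "foldr simple_refl (alternating (2 * ord (s \<otimes> t)) s t) v = v"
proof -
  have triv: "foldr simple_refl (concat (replicate n [s, t])) v = v"
    if "\<And>v. simple_refl s (simple_refl t v) = v" for n v
    using that by (induction n) auto
  have ev: "foldr simple_refl (concat (replicate (2 * n) [s, t])) v = v"
    if "\<And>v. simple_refl s (simple_refl t (simple_refl s (simple_refl t v))) = v" for n v
    using that by (induction n) auto
  consider "s = t \<or> (s \<notin> J \<and> t \<notin> J)" | "s \<noteq> t" "s \<in> J" "t \<in> J" | "s \<in> J \<longleftrightarrow> t \<notin> J" by blast
  then show ?thesis
  proof cases
    case 1
    then have "simple_refl s (simple_refl t v) = v" for v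
      by (elim disjE) (simp add: simple_refl_square, simp add: simple_refl_def)
    then show ?thesis using triv by (simp add: alternating_double)
  next
    case 2
    let ?n = "2 * ord (s \<otimes> t)"
    note ang = dihedral_angle[OF assms 2(1)]
    have "foldr simple_refl (alternating ?n s t) v = fold simple_refl (alternating ?n t s) v"
      by (simp add: foldr_conv_fold alternating_double rev_concat)
    also have "\<dots> = fold B.reflect (alternating ?n (simple_root t) (simple_root s)) v"
    proof -
      have "fold simple_refl l v = fold B.reflect (map simple_root l) v" if "set l \<subseteq> J" for l v
        using that by (induction l arbitrary: v) (auto simp: simple_refl_def)
      moreover have "set (alternating ?n t s) \<subseteq> J" using set_alternating[of ?n t s] 2 by auto
      ultimately show ?thesis by (simp add: map_alternating)
    qed
    also have "\<dots> = v"
      using sin_gt_zero[OF ang(1,2)]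
      by (intro B.dihedral_relation[OF _ _ B_simple_root_self[OF 2(2)] B_simple_root_self[OF 2(3)]
            B_simple_root[OF 2(2,3)] ang(3)]) auto
    finally show ?thesis .
  next
    case 3
    have "even (ord (s \<otimes> t))"
    proof (cases "s \<in> J")
      case True
      with 3 assms even_ord[of s t] show ?thesis by blast
    next
      case False
      with 3 assms even_ord[of t s] ord_swap[of s t] show ?thesis by simp
    qed
    then obtain n where n: "ord (s \<otimes> t) = 2 * n" by (elim evenE)
    have "simple_refl s (simple_refl t (simple_refl s (simple_refl t v))) = v" for v
      using 3 simple_refl_square[of s v] simple_refl_square[of t v] by (cases "s \<in> J") (simp_all add: simple_refl_def)
    then show ?thesis using ev[of n v] unfolding alternating_double n by blast
  qed
qed

definition rho :: "'a \<Rightarrow> ('a \<Rightarrow> real) \<Rightarrow> ('a \<Rightarrow> real)" where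
  "rho g = foldr simple_refl (SOME l. set l \<subseteq> S \<and> word_prod l = g)"

lemma rho_word:
  assumes "set l \<subseteq> S"
  shows "rho (word_prod l) v = foldr simple_refl l v"
proof -
  let ?k = "SOME k. set k \<subseteq> S \<and> word_prod k = word_prod l"
  have "set ?k \<subseteq> S \<and> word_prod ?k = word_prod l"
    by (rule someI[of "\<lambda>k. set k \<subseteq> S \<and> word_prod k = word_prod l" l]) (simp add: assms)
  then have "foldr simple_refl ?k v = foldr simple_refl l v"
    by (intro word_action_unique[OF _ assms _ simple_refl_square simple_refl_relation]) blast+
  then show ?thesis by (simp add: rho_def)
qed

lemma rho_one: "rho \<one> v = v"
  using rho_word[of "[]"] by simp

lemma rho_simple: "s \<in> S \<Longrightarrow> rho s v = simple_refl s v"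
  using rho_word[of "[s]"] S_carrier by auto

lemma rho_mult:
  assumes "g \<in> carrier G" "h \<in> carrier G"
  shows "rho (g \<otimes> h) v = rho g (rho h v)"
proof -
  obtain k where k: "set k \<subseteq> S" "word_prod k = g" using word_exists[OF assms(1)] by blast
  obtain l where l: "set l \<subseteq> S" "word_prod l = h" using word_exists[OF assms(2)] by blast
  have "word_prod (k @ l) = g \<otimes> h"
    using k l S_carrier foldr_mult_append[of k l] by (simp del: foldr_append)
  then have "rho (g \<otimes> h) v = foldr simple_refl (k @ l) v"
    using rho_word[of "k @ l" v] k l by simp
  then show ?thesis
    using rho_word[OF k(1)] rho_word[OF l(1), of v] k(2) l(2) by simp
qed

lemma rho_inv: "g \<in> carrier G \<Longrightarrow> rho g (rho (inv g) v) = v" "g \<in> carrier G \<Longrightarrow> rho (inv g) (rho g v) = v"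
  using rho_mult[of g "inv g" v] rho_mult[of "inv g" g v] by (simp_all add: rho_one)

definition V :: "('a \<Rightarrow> real) set" where
  "V = {v. \<forall>x. x \<notin> J \<longrightarrow> v x = 0}"

lemma subspace_supported: "subspace V"
  by (auto simp: subspace_def V_def scaleR_fun_def)

lemma simple_root_V: "s \<in> J \<Longrightarrow> simple_root s \<in> V"
  by (auto simp: V_def simple_root_def)

lemma simple_refl_linear:
  "simple_refl s (v + w) = simple_refl s v + simple_refl s w" "simple_refl s (c *\<^sub>R v) = c *\<^sub>R simple_refl s v"
  unfolding simple_refl_def by (simp_all only: B.reflect_add[OF UNIV_I UNIV_I UNIV_I]
      B.reflect_scale[OF UNIV_I UNIV_I] if_distrib split: if_split) simp_all

lemma rho_linear:
  assumes "g \<in> carrier G"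
  shows "rho g (v + w) = rho g v + rho g w" "rho g (c *\<^sub>R v) = c *\<^sub>R rho g v" "v \<in> V \<Longrightarrow> rho g v \<in> V"
proof -
  obtain l where l: "set l \<subseteq> S" "word_prod l = g" using word_exists assms by blast
  have "foldr simple_refl l (v + w) = foldr simple_refl l v + foldr simple_refl l w"
    by (induction l) (simp_all only: foldr.simps comp_def id_def simple_refl_linear)
  moreover have "foldr simple_refl l (c *\<^sub>R v) = c *\<^sub>R foldr simple_refl l v"
    by (induction l) (simp_all only: foldr.simps comp_def id_def simple_refl_linear)
  moreover have "foldr simple_refl l v \<in> V" if "v \<in> V"
    using that simple_root_V
    by (induction l) (auto simp: simple_refl_def B.reflect_def subspace_diff[OF subspace_supported] subspace_scale[OF subspace_supported])
  ultimately show "rho g (v + w) = rho g v + rho g w" "rho g (c *\<^sub>R v) = c *\<^sub>R rho g v" "v \<in> V \<Longrightarrow> rho g v \<in> V"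
    using rho_word[OF l(1)] l(2) by auto
qed

text \<open>Averaging over the group makes the standard scalar product of coordinate vectors invariant.\<close>
definition ip :: "('a \<Rightarrow> real) \<Rightarrow> ('a \<Rightarrow> real) \<Rightarrow> real" where
  "ip v w = (\<Sum>g\<in>carrier G. \<Sum>x\<in>J. rho g v x * rho g w x)"

sublocale euclidean_form V ip
proof
  show "subspace V" by (rule subspace_supported)
  show "ip x y = ip y x" for x y by (simp add: ip_def mult.commute)
  show "ip (x + y) z = ip x z + ip y z" for x y z
  proof -
    have "(\<Sum>a\<in>J. rho g (x + y) a * rho g z a) =
        (\<Sum>a\<in>J. rho g x a * rho g z a) + (\<Sum>a\<in>J. rho g y a * rho g z a)"
      if "g \<in> carrier G" for g
      by (simp only: rho_linear[OF that] plus_fun_apply distrib_right sum.distrib)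
    then show ?thesis by (simp add: ip_def sum.distrib)
  qed
  show "ip (c *\<^sub>R x) z = c * ip x z" for c x z
  proof -
    have "(\<Sum>a\<in>J. rho g (c *\<^sub>R x) a * rho g z a) = c * (\<Sum>a\<in>J. rho g x a * rho g z a)"
      if "g \<in> carrier G" for g
      by (simp only: rho_linear[OF that]) (simp add: scaleR_fun_def sum_distrib_left mult.assoc)
    then show ?thesis by (simp add: ip_def sum_distrib_left)
  qed
  show "ip v v > 0" if v: "v \<in> V" "v \<noteq> 0" for v
  proof -
    obtain x where "v x \<noteq> 0" using v(2) by (auto simp: fun_eq_iff)
    then have x: "v x \<noteq> 0" "x \<in> J" using v(1) by (auto simp: V_def)
    have "0 < (\<Sum>x\<in>J. rho \<one> v x * rho \<one> v x)"
      using x finite_J by (intro sum_pos2[of J x]) (auto simp: rho_one zero_less_mult_iff linorder_neq_iff)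
    then show ?thesis
      unfolding ip_def using finite_carrier
      by (intro sum_pos2[of "carrier G" \<one>]) (auto intro: sum_nonneg)
  qed
qed

lemma ip_invariant:
  assumes h: "h \<in> carrier G"
  shows "ip (rho h v) (rho h w) = ip v w"
proof -
  have "ip (rho h v) (rho h w) = (\<Sum>g\<in>carrier G. \<Sum>x\<in>J. rho (g \<otimes> h) v x * rho (g \<otimes> h) w x)"
    using h by (simp add: ip_def rho_mult)
  also have "\<dots> = ip v w"
    unfolding ip_def
    by (rule sum.reindex_bij_witness[of _ "\<lambda>g. g \<otimes> inv h" "\<lambda>g. g \<otimes> h"]) (use h in \<open>auto simp: m_assoc\<close>)
  finally show ?thesis .
qed

lemma simple_root_pos: "s \<in> J \<Longrightarrow> ip (simple_root s) (simple_root s) > 0"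
  by (rule ip_pos[OF simple_root_V]) (auto simp: simple_root_def fun_eq_iff intro: exI[of _ s])

text \<open>Invariance under \<open>s\<close>, which negates its simple root, forces the averaged product with this root to be
  proportional to the Coxeter form; so \<open>s\<close> is also an orthogonal reflection for \<open>ip\<close>.\<close>
lemma ip_simple_root:
  assumes s: "s \<in> J" and v: "v \<in> V"
  shows "ip v (simple_root s) = ip (simple_root s) (simple_root s) * B v (simple_root s)"
proof -
  have sS: "s \<in> S" "s \<in> carrier G" using s J_S S_carrier by auto
  have sg: "rho s u = u - (2 * B u (simple_root s)) *\<^sub>R simple_root s" for u
    unfolding rho_simple[OF sS(1)] simple_refl_def B.reflect_def using s by (simp only: if_True)
  have "simple_root s - (2 * 1) *\<^sub>R simple_root s = (1 - 2 * 1) *\<^sub>R simple_root s"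
    by (simp only: scaleR_left_diff_distrib scaleR_one)
  then have e: "rho s v = v - (2 * B v (simple_root s)) *\<^sub>R simple_root s" "rho s (simple_root s) = (-1) *\<^sub>R simple_root s"
    unfolding sg B_simple_root_self[OF s] by simp_all
  have "ip v (simple_root s) = ip (v - (2 * B v (simple_root s)) *\<^sub>R simple_root s) ((-1) *\<^sub>R simple_root s)"
    using ip_invariant[OF sS(2), of v "simple_root s"] by (simp only: e)
  also have "\<dots> = - (ip v (simple_root s) - 2 * B v (simple_root s) * ip (simple_root s) (simple_root s))"
    using v simple_root_V[OF s] ip_scale_right[of "simple_root s" "v - (2 * B v (simple_root s)) *\<^sub>R simple_root s" "-1"]
    by (simp add: ip_diff_left ip_scale_left)
  finally show ?thesis by (simp add: algebra_simps)
qed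

definition unit_root :: "'a \<Rightarrow> 'a \<Rightarrow> real" where
  "unit_root s = (1 / sqrt (ip (simple_root s) (simple_root s))) *\<^sub>R simple_root s"

lemma unit_root_V: "s \<in> J \<Longrightarrow> unit_root s \<in> V"
  by (simp add: unit_root_def simple_root_V)

lemma unit_root_unit: "s \<in> J \<Longrightarrow> ip (unit_root s) (unit_root s) = 1"
  using simple_root_pos[of s] by (simp add: unit_root_def ip_scale_left ip_scale_right simple_root_V)

lemma simple_refl_reflect:
  assumes "s \<in> J" "v \<in> V"
  shows "simple_refl s v = reflect (unit_root s) v"
proof -
  define c where "c = ip (simple_root s) (simple_root s)"
  have c: "c > 0" using simple_root_pos assms by (simp add: c_def)
  have "(2 * ip v (unit_root s)) *\<^sub>R unit_root s = (2 * (c * B v (simple_root s)) / (sqrt c * sqrt c)) *\<^sub>R simple_root s"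
    using assms by (simp add: unit_root_def ip_scale_right simple_root_V ip_simple_root flip: c_def)
  also have "\<dots> = (2 * B v (simple_root s)) *\<^sub>R simple_root s" using c by simp
  finally show ?thesis using assms by (simp add: simple_refl_def reflect_def B.reflect_def)
qed

lemma conj_reflect:
  assumes "s \<in> J" "g \<in> carrier G" "v \<in> V"
  shows "rho (g \<otimes> s \<otimes> inv g) v = reflect (rho g (unit_root s)) v"
proof -
  have sS: "s \<in> S" "s \<in> carrier G" using assms J_S S_carrier by auto
  let ?w = "rho (inv g) v"
  have w: "?w \<in> V" using assms rho_linear by simp
  have "rho (g \<otimes> s \<otimes> inv g) v = rho g (rho s ?w)" using assms sS by (simp add: rho_mult m_assoc)
  also have "\<dots> = rho g (?w - (2 * ip ?w (unit_root s)) *\<^sub>R unit_root s)"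
    using sS assms w by (simp add: rho_simple simple_refl_reflect reflect_def)
  also have "\<dots> = rho g ?w + rho g ((- 2 * ip ?w (unit_root s)) *\<^sub>R unit_root s)"
    using rho_linear(1)[OF assms(2), of ?w "(- 2 * ip ?w (unit_root s)) *\<^sub>R unit_root s"] by simp
  also have "\<dots> = v - (2 * ip ?w (unit_root s)) *\<^sub>R rho g (unit_root s)"
    by (simp only: rho_linear(2)[OF assms(2)] rho_inv(1)[OF assms(2)]) simp
  also have "ip ?w (unit_root s) = ip v (rho g (unit_root s))"
    using ip_invariant[OF assms(2), of ?w "unit_root s"] rho_inv(1)[OF assms(2), of v] by simp
  finally show ?thesis unfolding reflect_def .
qed

lemma conj_trivial:
  assumes "s \<in> S" "s \<notin> J" "g \<in> carrier G"
  shows "rho (g \<otimes> s \<otimes> inv g) v = v"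
  using assms S_carrier by (auto simp: rho_mult m_assoc rho_simple simple_refl_def rho_inv subset_iff)

lemma V_span: "V = span (simple_root ` J)"
proof
  show "span (simple_root ` J) \<subseteq> V" using simple_root_V subspace_supported by (intro span_minimal) auto
  show "V \<subseteq> span (simple_root ` J)"
  proof
    fix v assume v: "v \<in> V"
    have "v = (\<Sum>s\<in>J. v s *\<^sub>R simple_root s)"
    proof
      fix x
      have "(\<Sum>s\<in>J. v s *\<^sub>R simple_root s) x = (\<Sum>s\<in>J. v s * simple_root s x)"
        by (induction J rule: infinite_finite_induct) (auto simp: scaleR_fun_def)
      also have "\<dots> = v x"
        using v finite_J by (auto simp: simple_root_def V_def if_distrib sum.delta' cong: if_cong)
      finally show "v x = (\<Sum>s\<in>J. v s *\<^sub>R simple_root s) x" by simp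
    qed
    then show "v \<in> span (simple_root ` J)"
      by (metis (no_types, lifting) imageI span_base span_scale span_sum)
  qed
qed

lemma simple_root_notin_span:
  assumes "s \<in> J" "A \<subseteq> J - {s}"
  shows "simple_root s \<notin> span (simple_root ` A)"
proof
  have "span (simple_root ` A) \<subseteq> {v. v s = 0}"
    using assms by (intro span_minimal) (auto simp: subspace_def scaleR_fun_def simple_root_def)
  moreover assume "simple_root s \<in> span (simple_root ` A)"
  ultimately show False by (auto simp: simple_root_def)
qed

lemma inj_simple_root: "inj simple_root"
  by (auto simp: inj_def simple_root_def fun_eq_iff split: if_splits)

lemma independent_simple_root: "independent (simple_root ` J)"
proof -
  have "simple_root ` J - {simple_root s} = simple_root ` (J - {s})" for s
    using inj_simple_root by (auto simp: inj_def)
  then show ?thesis using simple_root_notin_span by (auto simp: dependent_def)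
qed

lemma independent_card_le:
  assumes "independent A" "A \<subseteq> V"
  shows "finite A \<and> card A \<le> card J"
  using independent_span_bound[of "simple_root ` J" A] assms V_span finite_J card_image_le[of J simple_root]
  by fastforce

text \<open>Generators that are not conjugate into \<open>J\<close> act trivially.  If the roots of the others did not span, a
  nonzero vector orthogonal to all of them would be fixed by the whole group, but no nonzero vector is orthogonal to
  all simple roots.\<close>
lemma card_generators_ge:
  assumes R: "finite R" "generate G R = carrier G"
    and refl: "R \<subseteq> reflections G S"
  shows "card J \<le> card {x \<in> R. \<exists>g\<in>carrier G. \<exists>s\<in>J. x = g \<otimes> s \<otimes> inv g}"
proof -
  let ?Y = "{x \<in> R. \<exists>g\<in>carrier G. \<exists>s\<in>J. x = g \<otimes> s \<otimes> inv g}"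
  have ex: "\<exists>r. r \<in> V \<and> (\<forall>v\<in>V. rho x v = reflect r v)" if "x \<in> ?Y" for x
  proof -
    obtain g s where gs: "g \<in> carrier G" "s \<in> J" "x = g \<otimes> s \<otimes> inv g" using \<open>x \<in> ?Y\<close> by auto
    then show ?thesis
      using conj_reflect[OF gs(2,1)] rho_linear(3)[OF gs(1) unit_root_V[OF gs(2)]] by blast
  qed
  obtain r where r0: "\<forall>x\<in>?Y. r x \<in> V \<and> (\<forall>v\<in>V. rho x v = reflect (r x) v)"
    using bchoice[of ?Y "\<lambda>x r. r \<in> V \<and> (\<forall>v\<in>V. rho x v = reflect r v)"] ex by blast
  then have r: "\<And>x. x \<in> ?Y \<Longrightarrow> r x \<in> V" "\<And>x v. x \<in> ?Y \<Longrightarrow> v \<in> V \<Longrightarrow> rho x v = reflect (r x) v"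
    by blast+
  have Y: "finite (r ` ?Y)" "r ` ?Y \<subseteq> V" using R r by auto
  have "simple_root s \<in> span (r ` ?Y)" if s: "s \<in> J" for s
  proof (rule ccontr)
    assume "simple_root s \<notin> span (r ` ?Y)"
    then obtain z where z: "z \<in> V" "\<forall>x\<in>r ` ?Y. ip z x = 0" "ip z (simple_root s) \<noteq> 0"
      using separating_vector[OF Y simple_root_V[OF s]] by blast
    let ?H = "{g \<in> carrier G. rho g z = z}"
    have H: "subgroup ?H G"
    proof (rule subgroupI)
      show "inv a \<in> ?H" if "a \<in> ?H" for a
        using that rho_inv(2)[of a z] by simp
      have "\<one> \<in> ?H" by (simp add: rho_one)
      then show "?H \<noteq> {}" by blast
    qed (auto simp: rho_mult)
    have "R \<subseteq> ?H"
    proof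
      fix x assume x: "x \<in> R"
      then obtain g t where gt: "g \<in> carrier G" "t \<in> S" "x = g \<otimes> t \<otimes> inv g"
        using refl by (auto simp: reflections_def)
      have "rho x z = z"
      proof (cases "t \<in> J")
        case True
        then have "x \<in> ?Y" using gt x by auto
        then show ?thesis using r(2)[OF _ z(1)] z(2) by (simp add: reflect_def)
      next
        case False
        then show ?thesis using gt conj_trivial by simp
      qed
      then show "x \<in> ?H" using gt S_carrier by auto
    qed
    then have "carrier G \<subseteq> ?H" using generate_subgroup_incl[OF _ H] R(2) by blast
    then have "rho s z = z" using s J_S S_carrier by blast
    then have "reflect (unit_root s) z = z" using s J_S z(1) by (auto simp: rho_simple simple_refl_reflect)
    then have "ip z (unit_root s) = 0" using reflect_eq_self_iff[OF unit_root_V unit_root_unit] s by blast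
    then have "ip z (simple_root s) = 0"
      using z(1) simple_root_V[OF s] simple_root_pos[OF s] by (simp add: unit_root_def ip_scale_right)
    with z(3) show False by simp
  qed
  then have "card (simple_root ` J) \<le> card (r ` ?Y)"
    using independent_span_bound[OF Y(1) independent_simple_root] by blast
  also have "\<dots> \<le> card ?Y" using R by (intro card_image_le) simp
  finally show ?thesis using card_image[OF inj_on_subset[OF inj_simple_root, of J]] by simp
qed

end

section \<open>Faithfulness of the geometric representation\<close>

lemma rev_alternating:
  "rev (alternating n x y) = (if even n then alternating n y x else alternating n x y)"
proof (induction n arbitrary: x y)
  case (Suc n)
  have "alternating (Suc n) x y = alternating n x y @ (if even n then [x] else [y])"
    using alternating_append[of n 1 x y] by simp
  then have "rev (alternating (Suc n) x y) = (if even n then x # alternating n y x else y # alternating n x y)"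
    using Suc.IH[of x y] by simp
  then show ?case by simp
qed simp

lemma not_distinct_adj_split:
  "\<not> distinct_adj l \<Longrightarrow> \<exists>us u vs. l = us @ [u, u] @ vs"
proof (induction l)
  case (Cons x l)
  show ?case
  proof (cases "distinct_adj l")
    case True
    with Cons.prems have "l \<noteq> []" "x = hd l" by (auto simp: distinct_adj_Cons)
    then have "x # l = [] @ [x, x] @ tl l" by (cases l) auto
    then show ?thesis by blast
  next
    case False
    then obtain us u vs where "l = us @ [u, u] @ vs" using Cons.IH by blast
    then have "x # l = (x # us) @ [u, u] @ vs" by simp
    then show ?thesis by blast
  qed
qed simp

lemma distinct_adj_alternating:
  assumes "set d \<subseteq> {s, t}" "distinct_adj d" "d \<noteq> [] \<Longrightarrow> hd d = t"
  shows "d = alternating (length d) t s"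
  using assms
proof (induction d arbitrary: s t)
  case (Cons x d)
  have x: "x = t" using Cons.prems(3) by simp
  have d: "set d \<subseteq> {t, s}" "distinct_adj d" using Cons.prems by (auto simp: distinct_adj_Cons)
  have "hd d = s" if "d \<noteq> []"
  proof -
    have "hd d \<in> {s, t}" using Cons.prems(1) hd_in_set[OF that] by auto
    moreover have "hd d \<noteq> t" using Cons.prems(2) that x by (auto simp: distinct_adj_Cons)
    ultimately show ?thesis by blast
  qed
  with Cons.IH[OF d] x show ?case by simp
qed simp

context finite_coxeter_system
begin

definition word_len :: "'a \<Rightarrow> nat" where
  "word_len g = (LEAST n. \<exists>l. set l \<subseteq> S \<and> word_prod l = g \<and> length l = n)"

lemma reduced_word:
  assumes "g \<in> carrier G"
  shows "\<exists>l. set l \<subseteq> S \<and> word_prod l = g \<and> length l = word_len g"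
  unfolding word_len_def
  by (rule LeastI_ex) (use word_exists[OF assms] in blast)

lemma word_len_le: "set l \<subseteq> S \<Longrightarrow> word_len (word_prod l) \<le> length l"
  unfolding word_len_def by (rule Least_le) blast

lemma word_carrier: "set l \<subseteq> S \<Longrightarrow> word_prod l \<in> carrier G"
  using S_carrier by auto

text \<open>All Coxeter relators have even length, so flipping a truth value at each letter
  satisfies the Coxeter relations.\<close>
lemma even_length_relation:
  assumes "set l \<subseteq> S" "word_prod l = \<one>"
  shows "even (length l)"
proof -
  have flip: "foldr (\<lambda>s. Not) k b = (if even (length k) then b else \<not> b)" for k :: "'a list" and b
    by (induction k) auto
  have "foldr (\<lambda>s. Not) l True = True"
    by (rule relation_acts_trivially[OF assms]) (simp_all add: flip)
  then show ?thesis by (auto simp: flip split: if_splits)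
qed

lemma word_len_word_mult:
  assumes "set d \<subseteq> S" "y \<in> carrier G"
  shows "word_len (word_prod d \<otimes> y) \<le> length d + word_len y"
proof -
  obtain l where l: "set l \<subseteq> S" "word_prod l = y" "length l = word_len y"
    using reduced_word[OF assms(2)] by blast
  have "word_prod (d @ l) = word_prod d \<otimes> y"
    using assms l S_carrier foldr_mult_append[of d l] by (simp del: foldr_append)
  with word_len_le[of "d @ l"] assms l show ?thesis by simp
qed

lemma word_len_simple_mult:
  assumes "s \<in> S" "y \<in> carrier G"
  shows "word_len (s \<otimes> y) \<le> Suc (word_len y)" "word_len y \<le> Suc (word_len (s \<otimes> y))" "word_len (s \<otimes> y) \<noteq> word_len y"
proof -
  have s: "s \<in> carrier G" using assms S_carrier by auto
  have "s \<otimes> (s \<otimes> y) = y" using s assms S_invol by (simp add: involution_cancel_left)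
  then show "word_len (s \<otimes> y) \<le> Suc (word_len y)" "word_len y \<le> Suc (word_len (s \<otimes> y))"
    using word_len_word_mult[of "[s]" y] word_len_word_mult[of "[s]" "s \<otimes> y"] assms s by auto
  show "word_len (s \<otimes> y) \<noteq> word_len y"
  proof
    assume eq: "word_len (s \<otimes> y) = word_len y"
    obtain l where l: "set l \<subseteq> S" "word_prod l = y" "length l = word_len y"
      using reduced_word[OF assms(2)] by blast
    obtain k where k: "set k \<subseteq> S" "word_prod k = s \<otimes> y" "length k = word_len (s \<otimes> y)"
      using reduced_word[of "s \<otimes> y"] assms s by auto
    have c: "set l \<subseteq> carrier G" "set k \<subseteq> carrier G" using l k S_carrier by auto
    have "word_prod (rev k @ (s # l)) = inv (s \<otimes> y) \<otimes> (s \<otimes> y)"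
      using c s l k by (subst foldr_mult_append) (auto simp: word_prod_rev)
    also have "\<dots> = \<one>" using s assms by simp
    finally have "even (length (rev k @ (s # l)))"
      using l k assms by (intro even_length_relation) auto
    then show False using l k eq by simp
  qed
qed

lemma alternating_pow:
  assumes "s \<in> S" "t \<in> S"
  shows "word_prod (alternating (2 * n) s t) = (s \<otimes> t) [^] n"
proof -
  have c: "s \<in> carrier G" "t \<in> carrier G" using assms S_carrier by auto
  show ?thesis
  proof (induction n)
    case (Suc n)
    have "word_prod (alternating (2 * Suc n) s t) = s \<otimes> t \<otimes> (s \<otimes> t) [^] n"
      using Suc c by (simp add: m_assoc)
    also have "\<dots> = (s \<otimes> t) [^] Suc n" using c nat_pow_Suc2[of "s \<otimes> t" n] by simp
    finally show ?case .
  qed simp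
qed

lemma braid_relation:
  assumes "s \<in> S" "t \<in> S"
  shows "word_prod (alternating (ord (s \<otimes> t)) s t) = word_prod (alternating (ord (s \<otimes> t)) t s)"
proof -
  let ?m = "ord (s \<otimes> t)"
  let ?A = "word_prod (alternating ?m s t)" and ?B = "word_prod (alternating ?m t s)"
  have sub: "set (alternating ?m s t) \<subseteq> S" "set (alternating ?m t s) \<subseteq> S"
    using assms set_alternating[of ?m s t] set_alternating[of ?m t s] by auto
  have car: "?A \<in> carrier G" "?B \<in> carrier G" using sub word_carrier by auto
  have c: "s \<otimes> t \<in> carrier G" using assms S_carrier by auto
  have "word_prod (alternating (?m + ?m) s t) = \<one>"
    using alternating_pow[OF assms, of ?m] pow_ord_eq_1[OF c] by (simp add: mult_2)
  then have 1: "?A \<otimes> (if even ?m then ?A else ?B) = \<one>"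
    using sub S_carrier unfolding alternating_append
    by (subst (asm) foldr_mult_append) (auto split: if_splits)
  have 2: "inv ?A = (if even ?m then ?B else ?A)"
    using word_prod_rev[OF sub(1)] by (simp add: rev_alternating split: if_splits)
  have 3: "inv ?A = (if even ?m then ?A else ?B)"
    using 1 car inv_cancel_left(1)[of ?A "if even ?m then ?A else ?B"] by simp
  show ?thesis using 2 3 by (auto split: if_splits)
qed

end

locale geometric_representation = coxeter_representation G S S
  for G :: "('a, 'b) monoid_scheme" (structure) and S
begin

lemma dominant_vector_exists: "\<exists>v\<in>V. \<forall>s\<in>S. ip v (simple_root s) > 0"
proof -
  have "\<exists>v\<in>V. (\<forall>s\<in>A. ip v (simple_root s) = 1) \<and> (\<forall>s\<in>S - A. ip v (simple_root s) = 0)" if "A \<subseteq> S" for A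
    using finite_subset[OF that finite_S] that
  proof (induction A rule: finite_induct)
    case empty
    have "\<forall>s\<in>S. ip 0 (simple_root s) = 0" using ip_zero_left simple_root_V by blast
    then show ?case using V_closed(1) by blast
  next
    case (insert s A)
    then obtain v where v: "v \<in> V" "\<forall>s\<in>A. ip v (simple_root s) = 1" "\<forall>s\<in>S - A. ip v (simple_root s) = 0"
      by auto
    have s: "s \<in> S" using insert by simp
    obtain z where z: "z \<in> V" "\<forall>x\<in>simple_root ` (S - {s}). ip z x = 0" "ip z (simple_root s) \<noteq> 0"
      using separating_vector[of "simple_root ` (S - {s})" "simple_root s"] finite_S simple_root_V s
        simple_root_notin_span[OF s, of "S - {s}"] by auto
    have eq: "ip (v + (1 / ip z (simple_root s)) *\<^sub>R z) (simple_root u) = ip v (simple_root u) + (if u = s then 1 else 0)"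
      if "u \<in> S" for u
      using v z that simple_root_V s by (simp add: ip_add_left ip_scale_left)
    have "ip (v + (1 / ip z (simple_root s)) *\<^sub>R z) (simple_root u) = 1" if "u \<in> insert s A" for u
      using that insert v eq[of u] by auto
    moreover have "ip (v + (1 / ip z (simple_root s)) *\<^sub>R z) (simple_root u) = 0" if "u \<in> S - insert s A" for u
      using that v eq[of u] by auto
    moreover have "v + (1 / ip z (simple_root s)) *\<^sub>R z \<in> V" using v z by simp
    ultimately show ?case by blast
  qed
  from this[of S] obtain v where "v \<in> V" "\<forall>s\<in>S. ip v (simple_root s) = 1" by auto
  then show ?thesis by (intro bexI[of _ v]) auto
qed

text \<open>Up to the factor \<open>sin \<theta> > 0\<close>, the inverse of the alternating word maps the simple root of \<open>s\<close> to a
  combination of the two simple roots whose coefficients are sines of angles between \<open>0\<close> and \<open>\<pi>\<close>.\<close>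
lemma alternating_orbit_positive:
  assumes st: "s \<in> S" "t \<in> S" "s \<noteq> t" and k: "k < ord (s \<otimes> t)"
    and p: "p \<in> V" "ip p (simple_root s) > 0" "ip p (simple_root t) > 0"
  shows "ip (foldr simple_refl (alternating k t s) p) (simple_root s) > 0"
proof -
  define \<theta> where "\<theta> = pi / real (ord (s \<otimes> t))"
  have ang: "0 < \<theta>" "\<theta> < pi" "real (ord (s \<otimes> t)) * \<theta> = pi"
    using dihedral_angle[OF st] by (simp_all add: \<theta>_def)
  let ?d = "alternating k t s"
  have dS: "set ?d \<subseteq> S" using set_alternating[of k t s] st by auto
  let ?g = "word_prod ?d"
  have g: "?g \<in> carrier G" using dS by (rule word_carrier)
  have "ip (foldr simple_refl ?d p) (simple_root s) = ip (rho ?g p) (rho ?g (rho (inv ?g) (simple_root s)))"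
    by (simp only: rho_word[OF dS, symmetric] rho_inv(1)[OF g])
  also have "\<dots> = ip p (rho (inv ?g) (simple_root s))" by (rule ip_invariant[OF g])
  also have "rho (inv ?g) (simple_root s) = fold simple_refl ?d (simple_root s)"
  proof -
    have "set (rev ?d) \<subseteq> S" using dS by simp
    from rho_word[OF this, of "simple_root s"] show ?thesis
      unfolding word_prod_rev[OF dS] by (simp only: foldr_conv_fold rev_rev_ident)
  qed
  also have fw: "fold simple_refl ?d (simple_root s) = fold B.reflect (alternating k (simple_root t) (simple_root s)) (simple_root s)"
  proof -
    have "fold simple_refl l v = fold B.reflect (map simple_root l) v" if "set l \<subseteq> S" for l v
      using that by (induction l arbitrary: v) (auto simp: simple_refl_def)
    with dS show ?thesis by (simp add: map_alternating)
  qed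
  finally have eq: "ip (foldr simple_refl ?d p) (simple_root s) =
    ip p (fold B.reflect (alternating k (simple_root t) (simple_root s)) (simple_root s))" .
  let ?w = "fold B.reflect (alternating k (simple_root t) (simple_root s)) (simple_root s)"
  have unit_root: "B (simple_root s) (simple_root s) = 1" "B (simple_root t) (simple_root t) = 1"
    and cos: "B (simple_root s) (simple_root t) = - cos \<theta>"
    using st by (simp_all only: B_simple_root_self B_simple_root \<theta>_def)
  have fr: "fold B.reflect (alternating k (simple_root t) (simple_root s)) (sin (0 + \<theta>) *\<^sub>R simple_root s + sin 0 *\<^sub>R simple_root t) =
    (if even k then sin (0 + real (k + 1) * \<theta>) *\<^sub>R simple_root s + sin (0 + real k * \<theta>) *\<^sub>R simple_root t
     else sin (0 + real (k + 1) * \<theta>) *\<^sub>R simple_root t + sin (0 + real k * \<theta>) *\<^sub>R simple_root s)"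
    by (rule B.fold_reflect_alternating[OF UNIV_I UNIV_I unit_root cos])
  have set: "set (alternating k (simple_root t) (simple_root s)) \<subseteq> UNIV" by simp
  have "sin \<theta> *\<^sub>R ?w = fold B.reflect (alternating k (simple_root t) (simple_root s)) (sin \<theta> *\<^sub>R simple_root s)"
    by (rule B.fold_reflect_linear(2)[OF set UNIV_I UNIV_I, symmetric])
  also have "\<dots> = fold B.reflect (alternating k (simple_root t) (simple_root s)) (sin (0 + \<theta>) *\<^sub>R simple_root s + sin 0 *\<^sub>R simple_root t)"
    by (simp only: sin_zero scaleR_zero_left add_0_left add_0_right)
  finally have w: "sin \<theta> *\<^sub>R ?w = (if even k
     then sin (0 + real (k + 1) * \<theta>) *\<^sub>R simple_root s + sin (0 + real k * \<theta>) *\<^sub>R simple_root t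
     else sin (0 + real (k + 1) * \<theta>) *\<^sub>R simple_root t + sin (0 + real k * \<theta>) *\<^sub>R simple_root s)"
    unfolding fr .
  define x y where "x = sin (real (k + 1) * \<theta>)" and "y = sin (real k * \<theta>)"
  have "real k * \<theta> < pi" "real (k + 1) * \<theta> \<le> pi"
    using k ang(1) unfolding ang(3)[symmetric] by simp_all
  then have xy: "x \<ge> 0" "y \<ge> 0" "x > 0 \<or> y > 0"
  proof -
    assume *: "real k * \<theta> < pi" "real (k + 1) * \<theta> \<le> pi"
    have "0 \<le> real k * \<theta>" "0 \<le> real (k + 1) * \<theta>" using ang(1) by simp_all
    with * show "x \<ge> 0" "y \<ge> 0" unfolding x_def y_def by (auto intro: sin_ge_zero)
    show "x > 0 \<or> y > 0"
    proof (cases "k = 0")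
      case True
      then show ?thesis using sin_gt_zero[OF ang(1,2)] by (simp add: x_def)
    next
      case False
      then have "0 < real k * \<theta>" using ang(1) by simp
      then show ?thesis using *(1) sin_gt_zero unfolding y_def by blast
    qed
  qed
  have aV: "simple_root s \<in> V" "simple_root t \<in> V" using st simple_root_V by auto
  have wV: "?w \<in> V"
  proof -
    have sV: "simple_refl u v \<in> V" if "u \<in> S" "v \<in> V" for u v
      using rho_linear(3)[of u v] rho_simple[of u v] S_carrier that by auto
    have "fold simple_refl l v \<in> V" if "set l \<subseteq> S" "v \<in> V" for l v
      using that by (induction l arbitrary: v) (simp_all add: sV)
    from this[OF dS aV(1)] show ?thesis unfolding fw .
  qed
  have "sin \<theta> * ip p ?w = ip p (sin \<theta> *\<^sub>R ?w)" using wV p(1) by (simp add: ip_scale_right)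
  also have "\<dots> = (if even k then x * ip p (simple_root s) + y * ip p (simple_root t)
       else x * ip p (simple_root t) + y * ip p (simple_root s))"
    unfolding w using p(1) aV by (simp add: ip_add_right ip_scale_right x_def y_def)
  also have "\<dots> > 0"
  proof -
    have "0 < x * a + y * b" if "a > 0" "b > 0" for a b
      using xy that by (auto simp: add_pos_nonneg add_nonneg_pos)
    with p(2,3) show ?thesis by simp
  qed
  finally have "sin \<theta> * ip p ?w > 0" .
  then show ?thesis unfolding eq using sin_gt_zero[OF ang(1,2)] by (simp add: zero_less_mult_iff)
qed

text \<open>Tits' argument.  If \<open>t\<close> starts a reduced word of \<open>g\<close>, write \<open>g = d y\<close> with \<open>d\<close> a word in \<open>s\<close> and \<open>t\<close>,
  lengths adding up, and \<open>y\<close> as short as possible.  Then \<open>s\<close> and \<open>t\<close> both lengthen \<open>y\<close>, so the induction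
  hypothesis applies to \<open>y\<close> twice, and \<open>d\<close> is an alternating word that starts with \<open>t\<close> and is shorter
  than the order of \<open>s \<otimes> t\<close>.\<close>
lemma length_increase_positive:
  assumes v0: "v0 \<in> V" "\<forall>s\<in>S. ip v0 (simple_root s) > 0"
  assumes "g \<in> carrier G" "s \<in> S" "word_len (s \<otimes> g) > word_len g"
  shows "ip (rho g v0) (simple_root s) > 0"
  using assms(3-5)
proof (induction "word_len g" arbitrary: g s rule: less_induct)
  case less
  note g = less.prems(1) and s = less.prems(2)
  obtain l where l: "set l \<subseteq> S" "word_prod l = g" "length l = word_len g" using reduced_word[OF g] by blast
  show ?case
  proof (cases l)
    case Nil
    then have "g = \<one>" using l(2) by simp
    then show ?thesis using v0 s by (simp only: rho_one)
  next
    case (Cons t l')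
    have tS: "t \<in> S" "set l' \<subseteq> S" using l Cons by auto
    define h where "h = word_prod l'"
    have c: "s \<in> carrier G" "t \<in> carrier G" "h \<in> carrier G"
      using s tS S_carrier word_carrier by (auto simp: h_def)
    have gth: "g = t \<otimes> h" using l(2) Cons by (simp add: h_def)
    have lenh: "word_len h < word_len g" "Suc (word_len h) = word_len g"
      using word_len_le[OF tS(2)] l(3) Cons word_len_simple_mult(1)[OF tS(1) c(3)] gth by (auto simp: h_def)
    have st: "s \<noteq> t"
    proof
      assume "s = t"
      then have "s \<otimes> g = h" using gth c s S_invol by (simp add: involution_cancel_left)
      with less.prems(3) lenh show False by simp
    qed
    define P where "P = (\<lambda>y. \<exists>d. set d \<subseteq> {s, t} \<and> y \<in> carrier G \<and> word_prod d \<otimes> y = g \<and>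
      length d + word_len y = word_len g)"
    have "P h" unfolding P_def using c gth lenh by (intro exI[of _ "[t]"]) auto
    then obtain y where y: "P y" and ymin: "\<And>z. P z \<Longrightarrow> word_len y \<le> word_len z"
      using ex_has_least_nat[of P h word_len] by blast
    then obtain d where d: "set d \<subseteq> {s, t}" "y \<in> carrier G" "word_prod d \<otimes> y = g"
        "length d + word_len y = word_len g"
      unfolding P_def by blast
    have ylt: "word_len y < word_len g" using ymin[OF \<open>P h\<close>] lenh by simp
    have dS: "set d \<subseteq> S" "set d \<subseteq> carrier G" using d s tS S_carrier by auto
    have up: "word_len (u \<otimes> y) > word_len y" if u: "u \<in> {s, t}" for u
    proof (rule ccontr)
      assume nup: "\<not> word_len y < word_len (u \<otimes> y)"
      have uS: "u \<in> S" "u \<in> carrier G" using u s tS c by auto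
      have lt: "Suc (word_len (u \<otimes> y)) = word_len y" "word_len (u \<otimes> y) < word_len y"
        using nup word_len_simple_mult[OF uS(1) d(2)] by auto
      have "word_prod (d @ [u]) \<otimes> (u \<otimes> y) = word_prod d \<otimes> (u \<otimes> (u \<otimes> y))"
        using dS uS d(2) foldr_mult_append[of d "[u]"] by (simp add: m_assoc del: foldr_append)
      also have "\<dots> = g" using uS d S_invol by (simp add: involution_cancel_left)
      finally have "P (u \<otimes> y)"
        unfolding P_def using d u uS lt by (intro exI[of _ "d @ [u]"]) auto
      from ymin[OF this] lt show False by simp
    qed
    have pos: "ip (rho y v0) (simple_root s) > 0" "ip (rho y v0) (simple_root t) > 0"
      using less.hyps[OF ylt d(2)] s tS up by auto
    have shorter: False if "set e \<subseteq> S" "word_prod e \<otimes> y = g" "length e < length d" for e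
      using word_len_word_mult[OF that(1) d(2)] that d(4) by simp
    have noS: False if "set e \<subseteq> S" "s \<otimes> g = word_prod e \<otimes> y" "length e < length d" for e
      using word_len_word_mult[OF that(1) d(2)] that d(4) less.prems(3) by simp
    have "distinct_adj d"
    proof (rule ccontr)
      assume "\<not> distinct_adj d"
      then obtain us u vs where duv: "d = us @ [u, u] @ vs" using not_distinct_adj_split by blast
      have sub: "set us \<subseteq> S" "u \<in> S" "set vs \<subseteq> S" using dS duv by auto
      have "foldr (\<otimes>) ([u, u] @ vs) \<one> = foldr (\<otimes>) vs \<one>"
        using sub S_carrier S_invol[of u] by (auto simp: involution_cancel_left subset_iff)
      then have "word_prod d = word_prod (us @ vs)" unfolding duv by simp
      then show False using shorter[of "us @ vs"] d(3) sub duv by auto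
    qed
    moreover have "hd d = t" if ne: "d \<noteq> []"
    proof (rule ccontr)
      assume "hd d \<noteq> t"
      then obtain e where e: "d = s # e" using ne d(1) by (cases d) auto
      have "s \<otimes> g = word_prod e \<otimes> y"
      proof -
        have ec: "word_prod e \<in> carrier G" using dS(2) e by auto
        have "g = s \<otimes> word_prod e \<otimes> y" using d(3) e by simp
        then show ?thesis
          using c ec d(2) S_invol(1)[OF s] by (simp add: m_assoc involution_cancel_left)
      qed
      with noS[of e] e dS show False by auto
    qed
    ultimately have alt: "d = alternating (length d) t s"
      by (intro distinct_adj_alternating[OF d(1)])
    let ?m = "ord (s \<otimes> t)"
    \<comment> \<open>A longer alternating word could be rewritten by the braid relation to start with \<open>s\<close>.\<close>
    have small: "length d < ?m"
    proof (rule ccontr)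
      assume "\<not> length d < ?m"
      then obtain j where j: "length d = ?m + j" using le_Suc_ex[of ?m "length d"] by auto
      define r where "r = (if even ?m then alternating j t s else alternating j s t)"
      have dr: "d = alternating ?m t s @ r"
        using alt unfolding j alternating_append r_def .
      have r: "d = alternating ?m t s @ r" "set r \<subseteq> S" "length r = j"
      proof -
        show "d = alternating ?m t s @ r" by (rule dr)
        show "set r \<subseteq> S" using dS(1) by (subst (asm) dr) simp
        show "length r = j" by (simp add: r_def)
      qed
      obtain m' where m': "?m = Suc m'" using ord_ge_2[OF s tS(1) st] by (cases ?m) auto
      let ?e = "alternating m' t s @ r"
      have es: "alternating ?m s t @ r = s # ?e" by (simp add: m')
      have sub: "set (alternating ?m s t) \<subseteq> carrier G" "set (alternating ?m t s) \<subseteq> carrier G"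
         "set ?e \<subseteq> S" "set r \<subseteq> carrier G"
        using set_alternating[of ?m s t] set_alternating[of ?m t s] set_alternating[of m' t s]
          s tS(1) r(2) S_carrier by auto
      have "word_prod d = word_prod (alternating ?m s t @ r)"
        unfolding r(1) using sub braid_relation[OF s tS(1)]
        by (simp add: foldr_mult_append del: foldr_append)
      also have "\<dots> = s \<otimes> word_prod ?e" by (simp only: es foldr.simps comp_def)
      finally have "g = s \<otimes> word_prod ?e \<otimes> y" using d(3) by simp
      then have "s \<otimes> g = word_prod ?e \<otimes> y"
        using c s S_invol word_carrier[OF sub(3)] d(2) by (simp add: m_assoc involution_cancel_left del: foldr_append)
      with noS[OF sub(3)] j m' r(3) show False by simp
    qed
    have "rho g v0 = foldr simple_refl d (rho y v0)"
      using rho_mult[of "word_prod d" y v0] rho_word[OF dS(1)] d(2,3) word_carrier[OF dS(1)] by simp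
    then show ?thesis
      using alternating_orbit_positive[OF s tS(1) st small _ pos] alt rho_linear(3)[OF d(2) v0(1)] by simp
  qed
qed

text \<open>For \<open>v0\<close> in the open dominant chamber and a first letter \<open>s\<close> of a reduced word of \<open>g\<close>, the vector
  \<open>g v0\<close> lies on the negative side of the hyperplane of \<open>s\<close>, so it differs from \<open>v0\<close>.\<close>
lemma rho_faithful:
  assumes g: "g \<in> carrier G" and id: "\<And>v. v \<in> V \<Longrightarrow> rho g v = v"
  shows "g = \<one>"
proof (rule ccontr)
  assume "g \<noteq> \<one>"
  obtain v0 where v0: "v0 \<in> V" "\<forall>s\<in>S. ip v0 (simple_root s) > 0" using dominant_vector_exists by blast
  obtain l where l: "set l \<subseteq> S" "word_prod l = g" "length l = word_len g" using reduced_word[OF g] by blast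
  then obtain s k where k: "l = s # k" using \<open>g \<noteq> \<one>\<close> by (cases l) auto
  let ?h = "word_prod k"
  have s: "s \<in> S" "set k \<subseteq> S" "s \<in> carrier G" using l k S_carrier by auto
  have h: "?h \<in> carrier G" using word_carrier s by blast
  have gs: "g = s \<otimes> ?h" using l k by simp
  have "word_len (s \<otimes> ?h) > word_len ?h" using word_len_le[OF s(2)] l k by simp
  then have pos: "ip (rho ?h v0) (simple_root s) > 0"
    using length_increase_positive[OF v0 h s(1)] by blast
  have hV: "rho ?h v0 \<in> V" using rho_linear(3)[OF h v0(1)] .
  have "rho s (rho g v0) = rho ?h v0"
    unfolding gs using rho_mult[OF s(3) h, of v0] simple_refl_square[of s "rho ?h v0"] rho_simple[OF s(1)] by simp
  then have "rho ?h v0 = simple_refl s v0" using id[OF v0(1)] rho_simple[OF s(1)] by simp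
  also have "\<dots> = v0 - (2 * B v0 (simple_root s)) *\<^sub>R simple_root s"
    unfolding simple_refl_def B.reflect_def using s(1) by (simp only: if_True)
  finally have "ip (rho ?h v0) (simple_root s) = ip v0 (simple_root s) - 2 * B v0 (simple_root s) * ip (simple_root s) (simple_root s)"
    using v0(1) simple_root_V[OF s(1)] by (simp only: ip_diff_left ip_scale_left V_closed)
  also have "\<dots> = - ip v0 (simple_root s)" using ip_simple_root[OF s(1) v0(1)] by simp
  finally show False using pos v0(2) s(1) by fastforce
qed

end

section \<open>Splitting off a square\<close>

context reflection_action
begin

text \<open>Of two equal neighbours, one can be carried to the end; the other one stays, so the
  generated group does not shrink.\<close>
lemma dependent_drop:
  assumes T: "set t \<subseteq> T" and dep: "\<not> indep_list (map root t)"
  shows "\<exists>u q. hurwitz_equiv G t (u @ [q]) \<and> generate G (set u) = generate G (set t)"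
proof -
  obtain us q vs where eq: "hurwitz_equiv G t (us @ [q, q] @ vs)"
    using dependent_square[OF T dep] by blast
  have tc: "set t \<subseteq> carrier G" using T T_carrier by blast
  have c: "q \<in> carrier G" "set vs \<subseteq> carrier G" using hurwitz_equiv_carrier[OF eq tc] by auto
  obtain q' where "hurwitz_equiv G (q # vs) (vs @ [q'])" using hurwitz_move_right[OF c(2,1)] by blast
  from hurwitz_equiv_append[OF this, of "us @ [q]" "[]"]
  have "hurwitz_equiv G (us @ [q, q] @ vs) ((us @ [q] @ vs) @ [q'])" by simp
  moreover have "generate G (set (us @ [q] @ vs)) = generate G (set t)"
    using hurwitz_equiv_generate[OF eq tc] by simp
  ultimately show ?thesis using hurwitz_equiv_trans[OF eq] by blast
qed

lemma independent_prefix: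
  assumes "set t \<subseteq> T"
  shows "\<exists>us vs. hurwitz_equiv G t (us @ vs) \<and> indep_list (map root us) \<and>
    generate G (set us) = generate G (set t)"
  using assms
proof (induction "length t" arbitrary: t rule: less_induct)
  case less
  show ?case
  proof (cases "indep_list (map root t)")
    case True
    then have "hurwitz_equiv G t (t @ []) \<and> indep_list (map root t) \<and>
      generate G (set t) = generate G (set t)" by simp
    then show ?thesis by blast
  next
    case False
    obtain u q where uq: "hurwitz_equiv G t (u @ [q])" "generate G (set u) = generate G (set t)"
      using dependent_drop[OF less.prems False] by blast
    have "set u \<subseteq> T" using hurwitz_equiv_conj_closed[OF uq(1) conj_T less.prems] by simp
    moreover have "length u < length t" using hurwitz_equiv_length[OF uq(1)] by simp
    ultimately obtain us vs where uv: "hurwitz_equiv G u (us @ vs)" "indep_list (map root us)"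
        "generate G (set us) = generate G (set u)"
      using less.hyps by blast
    have "hurwitz_equiv G t (us @ (vs @ [q]))"
      using hurwitz_equiv_trans[OF uq(1)] hurwitz_equiv_append[OF uv(1), of "[]" "[q]"] by simp
    with uv uq(2) show ?thesis by blast
  qed
qed

end

context finite_coxeter_system
begin

text \<open>For \<open>m = 2 k + 1\<close> the braid relation reads \<open>w s = t w\<close> with \<open>w\<close> alternating of length \<open>2 k\<close>.\<close>
lemma odd_order_conjugate:
  assumes "s \<in> S" "t \<in> S" "odd (ord (s \<otimes> t))"
  shows "\<exists>g\<in>carrier G. t = g \<otimes> s \<otimes> inv g"
proof -
  obtain k where k: "ord (s \<otimes> t) = 2 * k + 1" using assms(3) by (elim oddE)
  let ?w = "word_prod (alternating (2 * k) s t)"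
  have c: "s \<in> carrier G" "t \<in> carrier G" using assms S_carrier by auto
  have sub: "set (alternating (2 * k) s t) \<subseteq> carrier G"
    using set_alternating[of "2 * k" s t] c by auto
  then have w: "?w \<in> carrier G" by (rule foldr_mult_carrier)
  have "word_prod (alternating (2 * k + 1) s t) = word_prod (alternating (2 * k) s t @ [s])"
    unfolding alternating_append by simp
  also have "\<dots> = ?w \<otimes> s" using sub c foldr_mult_append[of _ "[s]"] by (simp del: foldr_append)
  finally have "?w \<otimes> s = t \<otimes> ?w" using braid_relation[OF assms(1,2)] by (simp add: k)
  then have "t = ?w \<otimes> s \<otimes> inv ?w" using w c by (simp add: m_assoc)
  with w show ?thesis by blast
qed

lemma coxeter_representation_class:
  assumes C: "conj_closed C"
  shows "coxeter_representation G S (S \<inter> C)" "coxeter_representation G S (S - C)"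
proof -
  have "even (ord (s \<otimes> t))" if "s \<in> S" "t \<in> S" "s \<in> C" "t \<notin> C" for s t
    using odd_order_conjugate[OF that(1,2)] conj_closedD(1)[OF C that(3)] that(4) by blast
  then show "coxeter_representation G S (S \<inter> C)" "coxeter_representation G S (S - C)"
    using ord_swap by (unfold_locales; force)+
qed

lemma class_generators_ge:
  assumes R: "finite R" "generate G R = carrier G" "R \<subseteq> reflections G S" and C: "conj_closed C"
  shows "card (S \<inter> C) \<le> card (R \<inter> C)" "card (S - C) \<le> card (R - C)"
proof -
  have iff: "g \<otimes> s \<otimes> inv g \<in> C \<longleftrightarrow> s \<in> C" if "g \<in> carrier G" "s \<in> S" for g s
    using conj_closed_iff(1)[OF C] that S_carrier by blast
  have "{x \<in> R. \<exists>g\<in>carrier G. \<exists>s\<in>S \<inter> C. x = g \<otimes> s \<otimes> inv g} \<subseteq> R \<inter> C"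
    "{x \<in> R. \<exists>g\<in>carrier G. \<exists>s\<in>S - C. x = g \<otimes> s \<otimes> inv g} \<subseteq> R - C"
    using iff by auto
  then show "card (S \<inter> C) \<le> card (R \<inter> C)" "card (S - C) \<le> card (R - C)"
    using coxeter_representation.card_generators_ge[OF coxeter_representation_class(1)[OF C] R]
      coxeter_representation.card_generators_ge[OF coxeter_representation_class(2)[OF C] R]
      card_mono[of "R \<inter> C"] card_mono[of "R - C"] R(1)
    by (meson finite_Diff finite_Int order_trans)+
qed

end

context geometric_representation
begin

lemma reflections_carrier: "reflections G S \<subseteq> carrier G"
  using S_carrier by (auto simp: reflections_def)

definition root :: "'a \<Rightarrow> 'a \<Rightarrow> real" where
  "root t = (SOME r. r \<in> V \<and> ip r r = 1 \<and> (\<forall>v\<in>V. rho t v = reflect r v))"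

lemma root_spec:
  assumes "t \<in> reflections G S"
  shows "root t \<in> V \<and> ip (root t) (root t) = 1 \<and> (\<forall>v\<in>V. rho t v = reflect (root t) v)"
proof -
  obtain g s where gs: "g \<in> carrier G" "s \<in> S" "t = g \<otimes> s \<otimes> inv g"
    using assms by (auto simp: reflections_def)
  let ?r = "rho g (unit_root s)"
  have "?r \<in> V" by (rule rho_linear(3)[OF gs(1) unit_root_V[OF gs(2)]])
  moreover have "ip ?r ?r = 1" unfolding ip_invariant[OF gs(1)] by (rule unit_root_unit[OF gs(2)])
  moreover have "\<forall>v\<in>V. rho t v = reflect ?r v" unfolding gs(3) using conj_reflect[OF gs(2,1)] by blast
  ultimately have "\<exists>r. r \<in> V \<and> ip r r = 1 \<and> (\<forall>v\<in>V. rho t v = reflect r v)" by blast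
  then show ?thesis unfolding root_def by (rule someI_ex)
qed

sublocale action: reflection_action G V ip "reflections G S" rho root
proof
  show "finite (reflections G S)" using finite_subset[OF reflections_carrier finite_carrier] .
  show "conj_closed (reflections G S)"
    unfolding conj_closed_def
  proof (intro conjI reflections_carrier ballI)
    fix x h assume x: "x \<in> reflections G S" and h: "h \<in> carrier G"
    then obtain g s where gs: "g \<in> carrier G" "s \<in> S" "s \<in> carrier G" "x = g \<otimes> s \<otimes> inv g"
      using S_carrier by (auto simp: reflections_def)
    have "h \<otimes> x \<otimes> inv h = (h \<otimes> g) \<otimes> s \<otimes> inv (h \<otimes> g)"
      using h gs by (simp add: m_assoc inv_mult_group)
    then show "h \<otimes> x \<otimes> inv h \<in> reflections G S"
      using m_closed[OF h gs(1)] gs(2) unfolding reflections_def by blast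
  qed
  show "t \<otimes> t = \<one>" if t: "t \<in> reflections G S" for t
  proof -
    obtain g s where gs: "g \<in> carrier G" "s \<in> S" "t = g \<otimes> s \<otimes> inv g"
      using t by (auto simp: reflections_def)
    then show ?thesis using conj_involution[OF gs(1) _ S_invol(1)[OF gs(2)]] S_carrier by blast
  qed
  show "rho (g \<otimes> h) v = rho g (rho h v)" if "g \<in> carrier G" "h \<in> carrier G" for g h v
    using rho_mult that by blast
  show "rho \<one> v = v" for v by (rule rho_one)
  show "root t \<in> V" "ip (root t) (root t) = 1" if "t \<in> reflections G S" for t
    using root_spec[OF that] by blast+
  show "rho t v = reflect (root t) v" if "t \<in> reflections G S" "v \<in> V" for t v
    using root_spec[OF that(1)] that(2) by blast
  show "s = t" if st: "s \<in> reflections G S" "t \<in> reflections G S"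
    and eq: "\<And>v. v \<in> V \<Longrightarrow> rho s v = rho t v" for s t
  proof -
    have c: "s \<in> carrier G" "t \<in> carrier G" using st reflections_carrier by auto
    have "rho (inv s \<otimes> t) v = v" if "v \<in> V" for v
      using c rho_mult[of "inv s" t v] eq[OF that] rho_inv(2)[of s v] by simp
    then have "inv s \<otimes> t = \<one>" using c by (intro rho_faithful) auto
    then show "s = t" using c inv_cancel_left(2)[of s t] by simp
  qed
qed

lemma indep_roots_length:
  assumes "set l \<subseteq> reflections G S" "indep_list (map root l)"
  shows "length l \<le> card S" "distinct l"
proof -
  have i: "independent (root ` set l)" "distinct (map root l)"
    using indep_list_independent[OF assms(2)] by auto
  have "root ` set l \<subseteq> V" using root_spec assms(1) by blast
  then have "card (root ` set l) \<le> card S" using independent_card_le[OF i(1)] by simp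
  moreover have "card (root ` set l) = length l" using distinct_card[OF i(2)] by simp
  ultimately show "length l \<le> card S" by simp
  show "distinct l" using i(2) by (simp add: distinct_map)
qed

text \<open>The independent prefix \<open>us\<close> has at most \<open>|S|\<close> entries and, by \<open>class_generators_ge\<close>, at least
  \<open>|S - C|\<close> of them are outside \<open>C\<close>.  So more than \<open>|S|\<close> entries of \<open>C\<close> remain in \<open>vs\<close>, and their roots
  are dependent.\<close>
lemma split_off_pair:
  assumes t: "set t \<subseteq> reflections G S" "generate G (set t) = carrier G"
    and C: "conj_closed C" "C \<subseteq> reflections G S"
    and many: "length (filter (\<lambda>x. x \<in> C) t) > card (S \<inter> C) + card S"
  shows "\<exists>u r. hurwitz_equiv G t (u @ [r, r]) \<and> generate G (set u) = carrier G \<and> r \<in> C"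
proof -
  let ?n = "\<lambda>xs. length (filter (\<lambda>x. x \<in> C) xs)"
  have tc: "set t \<subseteq> carrier G" using t(1) reflections_carrier by blast
  obtain us vs where eq: "hurwitz_equiv G t (us @ vs)" and ind: "indep_list (map root us)"
      and gen: "generate G (set us) = carrier G"
    using action.independent_prefix[OF t(1)] t(2) by auto
  have sub: "set us \<subseteq> reflections G S" "set vs \<subseteq> reflections G S"
    using hurwitz_equiv_conj_closed[OF eq action.conj_T t(1)] by auto
  have us: "length us \<le> card S" "distinct us" using indep_roots_length[OF sub(1) ind] by auto
  have "?n us = card (set us \<inter> C)"
    using us(2) distinct_card[of "filter (\<lambda>x. x \<in> C) us"] by (simp add: Int_def)
  moreover have "card (set us \<inter> C) + card (set us - C) \<le> card (S \<inter> C) + card (S - C)"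
    using us distinct_card[OF us(2)] card_Int_Diff[of "set us" C] card_Int_Diff[OF finite_S, of C] by simp
  moreover have "card (S - C) \<le> card (set us - C)"
    using class_generators_ge(2)[OF _ gen sub(1) C(1)] by simp
  ultimately have "?n us \<le> card (S \<inter> C)" by linarith
  moreover have "?n us + ?n vs = ?n t" using hurwitz_equiv_count[OF eq C(1) tc] by simp
  ultimately have nvs: "?n vs > card S" using many by linarith
  have vc: "set vs \<subseteq> carrier G" using sub reflections_carrier by blast
  obtain ys zs where yz: "hurwitz_equiv G vs (ys @ zs)" "set ys \<subseteq> C" "length ys = ?n vs"
    using hurwitz_collect_class[OF vc] by blast
  have yR: "set ys \<subseteq> reflections G S" using yz(2) C(2) by blast
  have "\<not> indep_list (map root ys)" using indep_roots_length(1)[OF yR] yz(3) nvs by auto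
  then obtain as r bs where r: "hurwitz_equiv G ys (as @ [r, r] @ bs)"
    using action.dependent_square[OF yR] by blast
  have rC: "r \<in> C" using hurwitz_equiv_conj_closed[OF r C(1) yz(2)] by simp
  have c: "set (bs @ zs) \<subseteq> carrier G" "r \<in> carrier G" "r \<otimes> r = \<one>"
    using hurwitz_equiv_carrier[OF r] yR reflections_carrier hurwitz_equiv_carrier[OF yz(1) vc]
      rC C(2) action.involution by auto
  note eq
  also have "hurwitz_equiv G (us @ vs) (us @ ys @ zs)"
    using hurwitz_equiv_append[OF yz(1), of us "[]"] by simp
  also have "hurwitz_equiv G \<dots> (us @ as @ [r, r] @ bs @ zs)"
    using hurwitz_equiv_append[OF r, of us zs] by simp
  also have "hurwitz_equiv G \<dots> ((us @ as @ bs @ zs) @ [r, r])"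
    using hurwitz_equiv_append[OF hurwitz_pair_right[OF c], of "us @ as" "[]"] by simp
  finally have fin: "hurwitz_equiv G t ((us @ as @ bs @ zs) @ [r, r])" .
  let ?u = "us @ as @ bs @ zs"
  have "set ?u \<subseteq> carrier G" using hurwitz_equiv_carrier[OF fin tc] by simp
  then have "generate G (set ?u) \<subseteq> carrier G" by (rule generate_incl)
  moreover have "carrier G \<subseteq> generate G (set ?u)"
    using mono_generate[of "set us" "set ?u"] gen by auto
  ultimately show ?thesis using fin rC by blast
qed

end

lemma class_multiplicity_filter: "class_multiplicity C ts = length (filter (\<lambda>x. x \<in> C) ts)"
  by (simp add: class_multiplicity_def length_filter_conv_card)

context finite_coxeter_system
begin

lemma reflection_classes_conj:
  assumes "C \<in> reflection_classes G S"
  shows "conj_closed C" "C \<subseteq> reflections G S"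
    "\<And>r r'. r \<in> C \<Longrightarrow> r' \<in> C \<Longrightarrow> \<exists>x\<in>carrier G. r' = x \<otimes> r \<otimes> inv x"
proof -
  obtain y where y: "y \<in> carrier G" "C = conjugacy_class G y"
    using assms by (auto simp: reflection_classes_def)
  show "C \<subseteq> reflections G S" using assms by (simp add: reflection_classes_def)
  show "conj_closed C"
    unfolding conj_closed_def
  proof (intro conjI ballI)
    show "C \<subseteq> carrier G" using y by (auto simp: conjugacy_class_def)
    fix x h assume "x \<in> C" "h \<in> carrier G"
    then obtain g where g: "g \<in> carrier G" "x = g \<otimes> y \<otimes> inv g"
      using y by (auto simp: conjugacy_class_def)
    have "h \<otimes> x \<otimes> inv h = (h \<otimes> g) \<otimes> y \<otimes> inv (h \<otimes> g)"
      using \<open>h \<in> carrier G\<close> g y by (simp add: m_assoc inv_mult_group)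
    then show "h \<otimes> x \<otimes> inv h \<in> C"
      using \<open>h \<in> carrier G\<close> g y by (auto simp: conjugacy_class_def)
  qed
  fix r r' assume "r \<in> C" "r' \<in> C"
  then obtain a b where ab: "a \<in> carrier G" "r = a \<otimes> y \<otimes> inv a" "b \<in> carrier G" "r' = b \<otimes> y \<otimes> inv b"
    using y by (auto simp: conjugacy_class_def)
  have "r' = (b \<otimes> inv a) \<otimes> r \<otimes> inv (b \<otimes> inv a)"
    using ab y by (simp add: m_assoc inv_mult_group inv_cancel_left)
  then show "\<exists>x\<in>carrier G. r' = x \<otimes> r \<otimes> inv x" using ab by blast
qed

lemma geometric: "geometric_representation G S"
  by unfold_locales auto

lemma full_factorization_split:
  assumes full: "full_reflection_factorization G S g t" and C: "C \<in> reflection_classes G S"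
    and many: "class_multiplicity C t > card (S \<inter> C) + card S"
  shows "\<exists>u r. hurwitz_equiv G t (u @ [r, r]) \<and> full_reflection_factorization G S g u \<and> r \<in> C"
proof -
  interpret geometric_representation G S by (rule geometric)
  have t: "set t \<subseteq> reflections G S" "foldr (\<otimes>) t \<one> = g" "generate G (set t) = carrier G"
    using full by (auto simp: full_reflection_factorization_def reflection_factorization_def)
  have tc: "set t \<subseteq> carrier G" using t(1) reflections_carrier by blast
  obtain u r where ur: "hurwitz_equiv G t (u @ [r, r])" "generate G (set u) = carrier G" "r \<in> C"
    using split_off_pair[OF t(1,3) reflection_classes_conj(1,2)[OF C]] many
    by (auto simp: class_multiplicity_filter)
  have sub: "set (u @ [r, r]) \<subseteq> reflections G S"
    using hurwitz_equiv_conj_closed[OF ur(1) action.conj_T t(1)] .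
  then have r: "r \<in> carrier G" "r \<otimes> r = \<one>" using reflections_carrier action.involution by auto
  have "foldr (\<otimes>) (u @ [r, r]) \<one> = g" using hurwitz_equiv_prod[OF ur(1) tc] t(2) by simp
  then have "foldr (\<otimes>) u \<one> = g" using r by simp
  with ur sub show ?thesis
    by (auto simp: full_reflection_factorization_def reflection_factorization_def)
qed

end

section \<open>Removing the bound\<close>

theorem theorem2p5:
  fixes W :: "('a, 'b) monoid_scheme" and S R :: "'a set" and n :: nat
  assumes "irreducible_coxeter_system W S"
    and "finite (carrier W)"
    and "\<not> dihedral_coxeter_system W S"
    and "n = card S"
    and "minimal_reflection_generating_set W S R"
    and "\<forall>g \<in> carrier W. \<forall>t t'.
           full_reflection_factorization W S g t \<longrightarrow>
           full_reflection_factorization W S g t' \<longrightarrow>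
           (\<forall>C \<in> reflection_classes W S.
              class_multiplicity C t = class_multiplicity C t' \<and>
              class_multiplicity C t' \<le> card (R \<inter> C) + n) \<longrightarrow>
           hurwitz_equiv W t t'"
  shows "\<forall>g \<in> carrier W. \<forall>t t'.
           full_reflection_factorization W S g t \<longrightarrow>
           full_reflection_factorization W S g t' \<longrightarrow>
           (\<forall>C \<in> reflection_classes W S.
              class_multiplicity C t = class_multiplicity C t') \<longrightarrow>
           hurwitz_equiv W t t'"
proof -
  have cox: "coxeter_system W S" using assms(1) by (simp add: irreducible_coxeter_system_def)
  then interpret group W by (simp add: coxeter_system_def)
  interpret finite_coxeter_system W S
    by unfold_locales (use cox assms(2) in auto)
  interpret geo: geometric_representation W S by (rule geometric)
  have R: "R \<subseteq> reflections W S" "generate W R = carrier W"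
    using assms(5) by (auto simp: minimal_reflection_generating_set_def)
  have finR: "finite R" using finite_subset[OF R(1)] geo.action.finite_T by blast
  have main: "hurwitz_equiv W t t'"
    if "g \<in> carrier W" "full_reflection_factorization W S g t" "full_reflection_factorization W S g t'"
      "\<forall>C \<in> reflection_classes W S. class_multiplicity C t = class_multiplicity C t'" for g t t'
    using that
  proof (induction "length t" arbitrary: t t' rule: less_induct)
    case less
    show ?case
    proof (cases "\<forall>C \<in> reflection_classes W S. class_multiplicity C t' \<le> card (R \<inter> C) + n")
      case True
      with less.prems assms(6) show ?thesis by blast
    next
      case False
      then obtain C where C: "C \<in> reflection_classes W S"
        and big: "class_multiplicity C t' > card (R \<inter> C) + n" by (auto simp: not_le)
      note CC = reflection_classes_conj[OF C]
      have "card (S \<inter> C) \<le> card (R \<inter> C)" by (rule class_generators_ge(1)[OF finR R(2,1) CC(1)])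
      then have many: "class_multiplicity C t > card (S \<inter> C) + card S"
          "class_multiplicity C t' > card (S \<inter> C) + card S"
        using big less.prems(4) C assms(4) by auto
      obtain u q where u: "hurwitz_equiv W t (u @ [q, q])" "full_reflection_factorization W S g u" "q \<in> C"
        using full_factorization_split[OF less.prems(2) C many(1)] by blast
      obtain u' r where u': "hurwitz_equiv W t' (u' @ [r, r])" "full_reflection_factorization W S g u'" "r \<in> C"
        using full_factorization_split[OF less.prems(3) C many(2)] by blast
      obtain x where x: "x \<in> carrier W" "r = x \<otimes>\<^bsub>W\<^esub> q \<otimes>\<^bsub>W\<^esub> inv\<^bsub>W\<^esub> x" using CC(3)[OF u(3) u'(3)] by blast
      have car: "set t \<subseteq> carrier W" "set t' \<subseteq> carrier W" "set u \<subseteq> carrier W"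
        using less.prems u geo.reflections_carrier
        by (auto simp: full_reflection_factorization_def reflection_factorization_def)
      have q: "q \<in> carrier W" "q \<otimes>\<^bsub>W\<^esub> q = \<one>\<^bsub>W\<^esub>"
        using u(3) CC(2) geo.reflections_carrier geo.action.involution by auto
      have "x \<in> generate W (set u)" using u(2) x(1) by (simp add: full_reflection_factorization_def)
      from hurwitz_pair_conj[OF car(3) q this]
      have tu: "hurwitz_equiv W t (u @ [r, r])"
        using hurwitz_equiv_trans[OF u(1)] x(2) by simp
      have "class_multiplicity D u = class_multiplicity D u'" if D: "D \<in> reflection_classes W S" for D
        using hurwitz_equiv_count[OF tu reflection_classes_conj(1)[OF D] car(1)]
          hurwitz_equiv_count[OF u'(1) reflection_classes_conj(1)[OF D] car(2)] less.prems(4) D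
        by (auto simp: class_multiplicity_filter split: if_splits)
      moreover have "length u < length t" using hurwitz_equiv_length[OF tu] by simp
      ultimately have "hurwitz_equiv W u u'"
        using less.hyps[of u u'] less.prems(1) u(2) u'(2) by blast
      then have "hurwitz_equiv W (u @ [r, r]) (u' @ [r, r])"
        using hurwitz_equiv_append[of W u u' "[]" "[r, r]"] by simp
      then show ?thesis
        using hurwitz_equiv_trans[OF tu] hurwitz_equiv_trans[OF _ hurwitz_equiv_sym[OF u'(1) car(2)]]
        by blast
    qed
  qed
  then show ?thesis by blast
qed

end
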